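(* Let $n\ge 0$ be an integer, $f\in L^{2}(\mathbb{R}^{+})$, $F=\mathrm{Ber}f$, and $z=x+is\in\mathbf U$. The true polyanalytic Bergman transform of order $n$ can be written as follows. (1) As a polyanalytic function of order $n+1$: $$\mathrm{Ber}^{n}f(z)=\frac{1}{(2i)^{n}n!}\sum_{k=0}^{n}(2i)^{k}\binom{n}{k}\frac{1}{k!}s^{k}F^{(k)}(z).$$ (2) In terms of analytic Bergman transforms of different orders: $$\mathrm{Ber}^{n}f(z)=\sum_{k=0}^{n}(-2)^{k}\binom{n}{k}s^{k}\,\mathrm{Ber}_{k+1}f(z).$$ (3) In terms of a wavelet transform: $$\mathrm{Ber}^{n}f(z)=s^{-1}W_{\Phi_{n}}(\mathcal{F}^{-1}f)(x,s).$$
   Context: $\mathbf{U}=\{z=x+is\in\mathbb{C}: s>0\}$ is the upper half plane, $\frac{d}{dz}=\frac12\left(\frac{\partial}{\partial x}-i\frac{\partial}{\partial s}\right)$, $\frac{d}{d\overline z}=\frac12\left(\frac{\partial}{\partial x}+i\frac{\partial}{\partial s}\right)$; a function $G$ is polyanalytic of order $N$ if $\left(\frac{d}{d\overline z}\right)^{N}G=0$. For $f\in L^{2}(\mathbb{R}^{+})$, the Bergman transform of order $\alpha$ is $\mathrm{Ber}_{\alpha}f(z)=\int_{0}^{\infty}t^{\alpha-1/2}f(t)e^{izt}\,dt$, $\mathrm{Ber}=\mathrm{Ber}_{1}$, and the true polyanalytic Bergman transform of order $n$ is $\mathrm{Ber}^{n}f(z)=\frac{1}{(2i)^{n}n!}\left(\frac{d}{dz}\right)^{n}\left[s^{n}\,\mathrm{Ber}f(z)\right]$.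 The Fourier transform is $\mathcal F f(\omega)=\int_{\mathbb R}f(x)e^{-ix\omega}\,dx$; functions in $L^2(\mathbb R^+)$ are extended by $0$ to $\mathbb R$ before applying $\mathcal F^{-1}$. $T_xg(t)=g(t-x)$, $D_sg(t)=s^{-1/2}g(s^{-1}t)$, and the wavelet transform is $W_gf(x,s)=\langle f,T_xD_sg\rangle_{L^2(\mathbb R)}$. The Laguerre function is $l_n^0(t)=\mathbf 1_{[0,\infty)}(t)e^{-t/2}L_n^0(t)$, with $L_n^0(t)=\sum_{k=0}^n(-1)^k\binom nk\frac{t^k}{k!}$, and $\Phi_n$ is defined by $\mathcal F\Phi_n(t)=t^{1/2}l_n^0(2t)$ (equal to $0$ for $t<0$).
   Formalization: The printed constants are false for the given definitions; what is proved has prefactor (2i)^{-2n} in (1), prefactor (2i)^{-2n} and an extra 1/k! in each term in (2), and the factor 2π(2i)^{-2n} in front of s^{-1}W in (3). *)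

theory Defs
  imports "HOL-Analysis.Analysis"
begin

definition upper_half_plane :: "complex set" where
  "upper_half_plane = {z. Im z > 0}"

text \<open>
  Elements of \<open>L\<^sup>2\<close> are represented by functions that are Borel measurable on the given set; every
  quantity below depends only on the almost-everywhere class.
\<close>

definition square_integrable_on :: "(real \<Rightarrow> complex) \<Rightarrow> real set \<Rightarrow> bool" where
  "square_integrable_on f A \<longleftrightarrow>
     set_borel_measurable lborel A f \<and> set_integrable lborel A (\<lambda>t. (cmod (f t))\<^sup>2)"

abbreviation square_integrable :: "(real \<Rightarrow> complex) \<Rightarrow> bool" where
  "square_integrable f \<equiv> square_integrable_on f UNIV"

definition L2_inner :: "(real \<Rightarrow> complex) \<Rightarrow> (real \<Rightarrow> complex) \<Rightarrow> complex" where
  "L2_inner f g = (LINT t|lborel. f t * cnj (g t))"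

definition L2_tendsto :: "(nat \<Rightarrow> real \<Rightarrow> complex) \<Rightarrow> (real \<Rightarrow> complex) \<Rightarrow> bool" where
  "L2_tendsto u g \<longleftrightarrow> (\<forall>k. square_integrable (u k)) \<and> square_integrable g \<and>
     (\<lambda>k. LINT t|lborel. (cmod (u k t - g t))\<^sup>2) \<longlonglongrightarrow> 0"

definition extend_zero :: "(real \<Rightarrow> complex) \<Rightarrow> real \<Rightarrow> complex" where
  "extend_zero f t = (if t > 0 then f t else 0)"

definition fourier :: "(real \<Rightarrow> complex) \<Rightarrow> real \<Rightarrow> complex" where
  "fourier f \<omega> = (LINT x|lborel. f x * exp (- (\<i> * of_real x * of_real \<omega>)))"

text \<open>
  The Fourier transform on \<open>L\<^sup>2\<close> is the continuous extension of the integral formula from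
  \<open>L\<^sup>1 \<inter> L\<^sup>2\<close>. It is given as a relation, since the transform is determined only almost everywhere.
\<close>

definition has_L2_fourier :: "(real \<Rightarrow> complex) \<Rightarrow> (real \<Rightarrow> complex) \<Rightarrow> bool" where
  "has_L2_fourier g h \<longleftrightarrow>
     (\<exists>u. (\<forall>k. integrable lborel (u k)) \<and> L2_tendsto u g \<and> L2_tendsto (\<lambda>k. fourier (u k)) h)"

text \<open>A representative, unique up to null sets by Plancherel's theorem.\<close>

definition inv_fourier :: "(real \<Rightarrow> complex) \<Rightarrow> real \<Rightarrow> complex" where
  "inv_fourier h = (SOME g. has_L2_fourier g h)"

definition translate :: "real \<Rightarrow> (real \<Rightarrow> complex) \<Rightarrow> real \<Rightarrow> complex" where
  "translate x g t = g (t - x)"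

definition dilate :: "real \<Rightarrow> (real \<Rightarrow> complex) \<Rightarrow> real \<Rightarrow> complex" where
  "dilate s g t = of_real (s powr (- 1/2)) * g (inverse s * t)"

definition wavelet :: "(real \<Rightarrow> complex) \<Rightarrow> (real \<Rightarrow> complex) \<Rightarrow> real \<Rightarrow> real \<Rightarrow> complex" where
  "wavelet g f x s = L2_inner f (translate x (dilate s g))"

definition laguerre :: "nat \<Rightarrow> real \<Rightarrow> real" where
  "laguerre n t = (\<Sum>k\<le>n. (-1) ^ k * real (n choose k) * (t ^ k / fact k))"

definition laguerre_fun :: "nat \<Rightarrow> real \<Rightarrow> real" where
  "laguerre_fun n t = indicator {0..} t * exp (- t / 2) * laguerre n t"

text \<open>The argument of \<open>inv_fourier\<close> vanishes for negative \<open>t\<close>, because \<open>laguerre_fun\<close> does.\<close>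

definition Phi :: "nat \<Rightarrow> real \<Rightarrow> complex" where
  "Phi n = inv_fourier (\<lambda>t. of_real (sqrt t * laguerre_fun n (2 * t)))"

definition d_dz :: "(complex \<Rightarrow> complex) \<Rightarrow> complex \<Rightarrow> complex" where
  "d_dz G z = (1/2) * (vector_derivative (\<lambda>x. G (Complex x (Im z))) (at (Re z))
                       - \<i> * vector_derivative (\<lambda>s. G (Complex (Re z) s)) (at (Im z)))"

definition d_dzbar :: "(complex \<Rightarrow> complex) \<Rightarrow> complex \<Rightarrow> complex" where
  "d_dzbar G z = (1/2) * (vector_derivative (\<lambda>x. G (Complex x (Im z))) (at (Re z))
                          + \<i> * vector_derivative (\<lambda>s. G (Complex (Re z) s)) (at (Im z)))"

text \<open>
  Real differentiability of the intermediate functions is required because \<open>vector_derivative\<close>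
  is total and carries no information at points of non-differentiability.
\<close>

definition polyanalytic_on :: "nat \<Rightarrow> (complex \<Rightarrow> complex) \<Rightarrow> complex set \<Rightarrow> bool" where
  "polyanalytic_on N G U \<longleftrightarrow>
     (\<forall>k<N. (d_dzbar ^^ k) G differentiable_on U) \<and> (\<forall>z\<in>U. (d_dzbar ^^ N) G z = 0)"

definition Ber :: "real \<Rightarrow> (real \<Rightarrow> complex) \<Rightarrow> complex \<Rightarrow> complex" where
  "Ber \<alpha> f z = (LINT t:{0<..}|lborel. of_real (t powr (\<alpha> - 1/2)) * f t * exp (\<i> * z * of_real t))"

definition poly_Ber :: "nat \<Rightarrow> (real \<Rightarrow> complex) \<Rightarrow> complex \<Rightarrow> complex" where
  "poly_Ber n f z =
     1 / ((2 * \<i>) ^ n * fact n) * (d_dz ^^ n) (\<lambda>w. of_real (Im w) ^ n * Ber 1 f w) z"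

text \<open>
  Normalisation. Since \<open>d_dz\<close> maps \<open>s = Im z\<close> to \<open>1 / (2 * \<i>)\<close>, Leibniz' rule gives
  \<open>(d_dz ^^ n) (s ^ n * F) = (\<Sum>k\<le>n. (n choose k) * (fact n / fact k) * s ^ k * F\<^bsup>(k)\<^esup> / (2 * \<i>) ^ (n - k))\<close>
  for holomorphic \<open>F\<close>, so \<open>poly_Ber n f\<close> carries the total factor \<open>1 / (2 * \<i>) ^ (2 * n)\<close> in front of
  the sum of the \<open>(2 * \<i>) ^ k * (n choose k) / fact k * s ^ k * F\<^bsup>(k)\<^esup>\<close>. With the unnormalised
  \<open>fourier\<close>, Plancherel's formula reads
  \<open>L2_inner (inv_fourier f) (inv_fourier g) = L2_inner f g / (2 * pi)\<close>.
  The source prints these three expansions with other scalar constants, which are not consistent with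
  the definitions above: prefactor \<open>1 / ((2 * \<i>) ^ n * fact n)\<close> for the expansion in derivatives,
  no prefactor and no \<open>1 / fact k\<close> for the expansion in \<open>Ber (k + 1)\<close>, and no prefactor
  for the wavelet formula.
\<close>

end

theory Submission
  imports Defs "HOL-Probability.Probability"
begin

text \<open>
  Write \<open>s = Im z\<close>. Everything follows from expressing the true polyanalytic transform through the
  integrals of the extended \<open>f\<close> against the kernels \<open>b\<^sub>k(z, t) = t ^ k * sqrt t * exp (\<i> * z * t)\<close>,
  \<open>t > 0\<close>; for \<open>k = 0, 1, \<dots>\<close> these integrals are the transforms \<open>Ber (k + 1) f\<close>.

  Each \<open>b\<^sub>k(z, -)\<close> is square integrable when \<open>s > 0\<close>, because of the factor \<open>exp (- s * t)\<close>. The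
  same factor, at height \<open>s / 2\<close>, dominates the difference quotients in \<open>z\<close>, so differentiation
  under the integral is allowed and multiplies the kernel by \<open>\<i> * t\<close>. Hence \<open>F = Ber 1 f\<close> is
  holomorphic and its \<open>k\<close>-th derivative is \<open>\<i> ^ k * Ber (k + 1) f\<close> (\<open>higher_deriv_Ber\<close>).

  For holomorphic \<open>H\<close>, the Wirtinger derivative \<open>\<partial>/\<partial>z\<close> sends \<open>(s ^ j / j!) * H\<close> to
  \<open>(s ^ j / j!) * H' + (s ^ (j - 1) / (j - 1)!) * H / (2 * \<i>)\<close>, whereas the conjugate one sends it to
  \<open>(\<i> / 2) * (s ^ (j - 1) / (j - 1)!) * H\<close>. The first rule, iterated with Pascal's identity, is
  Leibniz' formula (\<open>d_dz_power_Leibniz\<close>) and gives both the expansion in derivatives of \<open>F\<close> and the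
  one in the transforms of higher order. The second lowers the degree in \<open>s\<close>, so \<open>n + 1\<close> applications
  annihilate a polynomial of degree \<open>n\<close> in \<open>s\<close> with holomorphic coefficients
  (\<open>polyanalytic_on_sum\<close>).

  For the wavelet formula, the dilated and modulated Laguerre function that is the Fourier
  transform of \<open>translate x (dilate s (Phi n))\<close> is, up to conjugation and a factor \<open>s\<close>, the combination of the
  kernels \<open>b\<^sub>k(z, -)\<close> with exactly the coefficients of the second expansion
  (\<open>bergman_kernel_dilate\<close>, \<open>laguerre_fun_conv_kernel\<close>). Parseval's formula then turns the inner
  product with \<open>f\<close> into the wavelet transform, with a factor \<open>2 * pi\<close>.

  This last step uses two facts about the Fourier transform on \<open>L\<^sup>2\<close>: Parseval's formula
  (\<open>L2_fourier_parseval\<close>) and surjectivity (\<open>has_L2_fourier_surj\<close>), the latter being what gives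
  \<open>inv_fourier\<close> a meaning. Both rest on Gaussian regularisation. Multiplying a Fourier transform
  by \<open>exp (- (d * t)\<^sup>2 / 2)\<close> and inverting it by the absolutely convergent integral returns the average
  of the original function against a Gaussian of width \<open>d\<close> (\<open>inverse_fourier_gauss_weight\<close>), and these
  averages converge in \<open>L\<^sup>2\<close> as \<open>d\<close> tends to \<open>0\<close> because translation is continuous in the mean
  (\<open>gauss_smooth_L2_tendsto\<close>).
\<close>

section \<open>Square integrable functions\<close>

abbreviation energy :: "(real \<Rightarrow> complex) \<Rightarrow> real" where
  "energy v \<equiv> LINT t|lborel. (cmod (v t))\<^sup>2"

lemma square_integrable_iff:
  "square_integrable v \<longleftrightarrow>
     v \<in> borel_measurable borel \<and> integrable lborel (\<lambda>t. (cmod (v t))\<^sup>2)"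
  by (simp add: square_integrable_on_def set_borel_measurable_def set_integrable_def)

lemma square_integrable_measurable [measurable_dest]:
  "square_integrable v \<Longrightarrow> v \<in> borel_measurable borel"
  by (simp add: square_integrable_iff)

lemma square_integrable_integrable:
  "square_integrable v \<Longrightarrow> integrable lborel (\<lambda>t. (cmod (v t))\<^sup>2)"
  by (simp add: square_integrable_iff)

lemma square_integrable_bound:
  assumes "integrable lborel g" "v \<in> borel_measurable borel" "\<And>t. (cmod (v t))\<^sup>2 \<le> g t"
  shows "square_integrable v"
  unfolding square_integrable_iff
  by (intro conjI assms Bochner_Integration.integrable_bound[OF assms(1)])
     (use assms in \<open>auto intro!: AE_I2 order_trans[OF assms(3)]\<close>)

lemma cmod_diff_square_le: "(cmod (a - b))\<^sup>2 \<le> 2 * (cmod a)\<^sup>2 + 2 * (cmod b)\<^sup>2"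
proof -
  have "(cmod (a - b))\<^sup>2 \<le> (cmod a + cmod b)\<^sup>2"
    by (intro power_mono norm_triangle_ineq4) auto
  also have "\<dots> \<le> 2 * (cmod a)\<^sup>2 + 2 * (cmod b)\<^sup>2"
    using sum_squares_bound[of "cmod a" "cmod b"] by (simp add: power2_sum)
  finally show ?thesis .
qed

lemma square_integrable_diff:
  assumes "square_integrable u" "square_integrable v"
  shows "square_integrable (\<lambda>t. u t - v t)"
    and energy_diff_le: "energy (\<lambda>t. u t - v t) \<le> 2 * energy u + 2 * energy v"
proof -
  note [measurable] = assms[THEN square_integrable_measurable]
  have I: "integrable lborel (\<lambda>t. 2 * (cmod (u t))\<^sup>2 + 2 * (cmod (v t))\<^sup>2)"
    using assms[THEN square_integrable_integrable] by simp
  show S: "square_integrable (\<lambda>t. u t - v t)"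
    by (rule square_integrable_bound[OF I]) (auto intro: cmod_diff_square_le)
  have "energy (\<lambda>t. u t - v t) \<le> (LINT t|lborel. 2 * (cmod (u t))\<^sup>2 + 2 * (cmod (v t))\<^sup>2)"
    by (intro integral_mono I square_integrable_integrable[OF S] cmod_diff_square_le)
  also have "\<dots> = 2 * energy u + 2 * energy v"
    using assms[THEN square_integrable_integrable] by simp
  finally show "energy (\<lambda>t. u t - v t) \<le> 2 * energy u + 2 * energy v" .
qed

lemma square_integrable_cmult:
  "square_integrable u \<Longrightarrow> square_integrable (\<lambda>t. c * u t)"
  by (auto simp: square_integrable_iff norm_mult power_mult_distrib)

lemma square_integrable_sum:
  "(\<And>a. a \<in> A \<Longrightarrow> square_integrable (h a)) \<Longrightarrow> square_integrable (\<lambda>t. \<Sum>a\<in>A. h a t)"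
proof (induction A rule: infinite_finite_induct)
  case (insert a A)
  have "square_integrable (\<lambda>t. h a t - (- 1) * (\<Sum>a\<in>A. h a t))"
    by (intro square_integrable_diff square_integrable_cmult insert) (use insert in auto)
  then show ?case
    using insert by simp
qed (simp_all add: square_integrable_iff)

lemma borel_measurable_cnj [measurable]: "cnj \<in> borel_measurable borel"
  by (intro borel_measurable_continuous_onI continuous_intros)

lemma square_integrable_cnj:
  "square_integrable u \<Longrightarrow> square_integrable (\<lambda>t. cnj (u t))"
  by (auto simp: square_integrable_iff)

lemma square_integrable_affine:
  assumes "square_integrable v" "c \<noteq> 0"
  shows "square_integrable (\<lambda>t. v (x + c * t))"
  using assms lborel_integrable_real_affine[of "\<lambda>t. (cmod (v t))\<^sup>2" c x]
  by (auto simp: square_integrable_iff)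

lemma energy_affine:
  assumes "c \<noteq> 0"
  shows "energy (\<lambda>t. v (x + c * t)) = energy v / \<bar>c\<bar>"
  using lborel_integral_real_affine[OF assms, of "\<lambda>t. (cmod (v t))\<^sup>2" x] assms
  by simp

lemma nn_integral_energy:
  "square_integrable u \<Longrightarrow> (\<integral>\<^sup>+t. ennreal ((cmod (u t))\<^sup>2) \<partial>lborel) = ennreal (energy u)"
  by (intro nn_integral_eq_integral square_integrable_integrable) auto

lemma square_integrable_nn_integral_le:
  assumes [measurable]: "u \<in> borel_measurable borel"
    and le: "(\<integral>\<^sup>+t. ennreal ((cmod (u t))\<^sup>2) \<partial>lborel) \<le> ennreal c" and "0 \<le> c"
  shows "square_integrable u" and "energy u \<le> c"
proof -
  show *: "square_integrable u"
    unfolding square_integrable_iff integrable_iff_bounded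
    using le by (auto intro: le_less_trans)
  show "energy u \<le> c"
    using le \<open>0 \<le> c\<close> nn_integral_energy[OF *] by simp
qed

lemma integrable_mult_square_integrable:
  assumes "square_integrable u" "square_integrable v"
  shows "integrable lborel (\<lambda>t. u t * v t)"
proof -
  note [measurable] = assms[THEN square_integrable_measurable]
  have I: "integrable lborel (\<lambda>t. (cmod (u t))\<^sup>2 + (cmod (v t))\<^sup>2)"
    using assms[THEN square_integrable_integrable] by simp
  have "cmod (u t * v t) \<le> (cmod (u t))\<^sup>2 + (cmod (v t))\<^sup>2" for t
    using sum_squares_bound[of "cmod (u t)" "cmod (v t)"]
      mult_nonneg_nonneg[OF norm_ge_zero norm_ge_zero, of "u t" "v t"]
    by (simp only: norm_mult mult.assoc)
  then show ?thesis
    by (intro Bochner_Integration.integrable_bound[OF I]) (auto intro!: AE_I2)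
qed

lemma L2_inner_Cauchy_Schwarz:
  assumes "square_integrable u" "square_integrable v"
  shows "(cmod (L2_inner u v))\<^sup>2 \<le> energy u * energy v"
proof -
  note [measurable] = assms[THEN square_integrable_measurable]
  have I: "integrable lborel (\<lambda>t. u t * cnj (v t))"
    by (intro integrable_mult_square_integrable square_integrable_cnj assms)
  have "ennreal ((cmod (L2_inner u v))\<^sup>2) \<le> (\<integral>\<^sup>+t. ennreal (cmod (u t)) * ennreal (cmod (v t)) \<partial>lborel)\<^sup>2"
  proof -
    have "ennreal (cmod (L2_inner u v)) \<le> (\<integral>\<^sup>+t. ennreal (cmod (u t)) * ennreal (cmod (v t)) \<partial>lborel)"
      using integral_norm_bound_ennreal[OF I] by (simp add: L2_inner_def norm_mult ennreal_mult)
    then show ?thesis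
      by (simp add: power_mono flip: ennreal_power)
  qed
  also have "\<dots> \<le> (\<integral>\<^sup>+t. ennreal (cmod (u t)) ^ 2 \<partial>lborel) * (\<integral>\<^sup>+t. ennreal (cmod (v t)) ^ 2 \<partial>lborel)"
    by (intro Cauchy_Schwarz_nn_integral) auto
  also have "\<dots> = ennreal (energy u * energy v)"
    using assms[THEN nn_integral_energy] by (simp add: ennreal_power ennreal_mult')
  finally show ?thesis
    by (simp add: integral_nonneg_AE)
qed

lemma L2_inner_diff_left:
  assumes "square_integrable u" "square_integrable v" "square_integrable w"
  shows "L2_inner (\<lambda>t. u t - v t) w = L2_inner u w - L2_inner v w"
  unfolding L2_inner_def
  by (simp add: left_diff_distrib integrable_mult_square_integrable square_integrable_cnj assms)

lemma L2_inner_diff_right: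
  assumes "square_integrable u" "square_integrable v" "square_integrable w"
  shows "L2_inner w (\<lambda>t. u t - v t) = L2_inner w u - L2_inner w v"
  unfolding L2_inner_def
  by (simp add: right_diff_distrib integrable_mult_square_integrable square_integrable_cnj assms)

text \<open>
  Cauchy--Schwarz bounds the square of an inner product, so limits of inner products are taken
  through their squared moduli.
\<close>

lemma tendsto_zero_power2_bound:
  fixes a :: "nat \<Rightarrow> complex"
  assumes "\<And>k. (cmod (a k))\<^sup>2 \<le> b k" "b \<longlonglongrightarrow> 0"
  shows "a \<longlonglongrightarrow> 0"
proof -
  have "(\<lambda>k. (cmod (a k))\<^sup>2) \<longlonglongrightarrow> 0"
    by (rule tendsto_sandwich[OF _ _ tendsto_const assms(2)]) (auto simp: assms)
  from tendsto_real_sqrt[OF this] show ?thesis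
    by (simp add: tendsto_norm_zero_iff)
qed

lemma L2_tendsto_energy_bounded:
  assumes "L2_tendsto u g"
  obtains B where "\<And>k. energy (u k) \<le> B" "0 \<le> B"
proof -
  from assms have S: "\<And>k. square_integrable (u k)" "square_integrable g"
    and lim: "(\<lambda>k. energy (\<lambda>t. u k t - g t)) \<longlonglongrightarrow> 0"
    by (auto simp: L2_tendsto_def)
  from convergent_imp_Bseq[OF convergentI[OF lim]] obtain C where
    C: "\<And>k. energy (\<lambda>t. u k t - g t) \<le> C"
    unfolding Bseq_def by (auto simp: abs_le_iff)
  have "energy (u k) \<le> 2 * \<bar>C\<bar> + 2 * energy g" for k
  proof -
    have "energy (\<lambda>t. (u k t - g t) - (- 1) * g t) \<le> 2 * energy (\<lambda>t. u k t - g t) + 2 * energy (\<lambda>t. (- 1) * g t)"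
      by (intro energy_diff_le square_integrable_diff square_integrable_cmult S)
    moreover have "energy (\<lambda>t. (u k t - g t) - (- 1) * g t) = energy (u k)"
      "energy (\<lambda>t. (- 1) * g t) = energy g"
      by simp_all
    moreover have "energy (\<lambda>t. u k t - g t) \<le> \<bar>C\<bar>"
      using C[of k] by linarith
    ultimately show ?thesis by linarith
  qed
  then show ?thesis
    by (rule that) (auto intro!: add_nonneg_nonneg integral_nonneg_AE)
qed

lemma L2_inner_tendsto:
  assumes "L2_tendsto u g" "L2_tendsto v h"
  shows "(\<lambda>k. L2_inner (u k) (v k)) \<longlonglongrightarrow> L2_inner g h"
proof -
  from assms have S: "\<And>k. square_integrable (u k)" "square_integrable g"
      "\<And>k. square_integrable (v k)" "square_integrable h"
    and lim: "(\<lambda>k. energy (\<lambda>t. u k t - g t)) \<longlonglongrightarrow> 0" "(\<lambda>k. energy (\<lambda>t. v k t - h t)) \<longlonglongrightarrow> 0"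
    by (auto simp: L2_tendsto_def)
  obtain B where B: "\<And>k. energy (v k) \<le> B" "0 \<le> B"
    using L2_tendsto_energy_bounded[OF assms(2)] by blast
  have 1: "(\<lambda>k. L2_inner (\<lambda>t. u k t - g t) (v k)) \<longlonglongrightarrow> 0"
  proof (rule tendsto_zero_power2_bound)
    show "(cmod (L2_inner (\<lambda>t. u k t - g t) (v k)))\<^sup>2 \<le> energy (\<lambda>t. u k t - g t) * B" for k
      by (rule order_trans[OF L2_inner_Cauchy_Schwarz mult_left_mono[OF B(1)]])
         (auto intro!: S square_integrable_diff integral_nonneg_AE)
  qed (use lim(1) in \<open>auto intro: tendsto_eq_intros\<close>)
  have 2: "(\<lambda>k. L2_inner g (\<lambda>t. v k t - h t)) \<longlonglongrightarrow> 0"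
  proof (rule tendsto_zero_power2_bound)
    show "(cmod (L2_inner g (\<lambda>t. v k t - h t)))\<^sup>2 \<le> energy g * energy (\<lambda>t. v k t - h t)" for k
      by (intro L2_inner_Cauchy_Schwarz S square_integrable_diff)
  qed (use lim(2) in \<open>auto intro: tendsto_eq_intros\<close>)
  have "(\<lambda>k. L2_inner (\<lambda>t. u k t - g t) (v k) + L2_inner g (\<lambda>t. v k t - h t) + L2_inner g h)
      \<longlonglongrightarrow> 0 + 0 + L2_inner g h"
    by (intro tendsto_add 1 2 tendsto_const)
  then show ?thesis
    by (simp add: L2_inner_diff_left L2_inner_diff_right S)
qed

lemma L2_tendsto_eventually_close:
  assumes "L2_tendsto u g" "0 < e"
  obtains k where "energy (\<lambda>t. u k t - g t) \<le> e"
proof -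
  from assms(1) have "(\<lambda>k. energy (\<lambda>t. u k t - g t)) \<longlonglongrightarrow> 0"
    by (simp add: L2_tendsto_def)
  from LIMSEQ_D[OF this assms(2)] obtain k where "norm (energy (\<lambda>t. u k t - g t) - 0) < e"
    by blast
  then show ?thesis
    by (intro that[of k]) auto
qed

text \<open>
  Applied twice below: on the side of the functions the multiplier is a constant, on the side of their
  Fourier transforms it is a character times a constant. In both cases only its modulus enters the norm.
\<close>

lemma L2_tendsto_affine:
  assumes lim: "L2_tendsto u g" and "c \<noteq> 0"
    and a [measurable]: "a \<in> borel_measurable borel" and A: "\<And>t. cmod (a t) = A"
  shows "L2_tendsto (\<lambda>k t. a t * u k (b + c * t)) (\<lambda>t. a t * g (b + c * t))"
proof -
  have sq: "square_integrable (\<lambda>t. a t * v (b + c * t))" if "square_integrable v" for v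
    using square_integrable_affine[OF that \<open>c \<noteq> 0\<close>, of b]
    by (auto simp: square_integrable_iff norm_mult power_mult_distrib A)
  have "energy (\<lambda>t. a t * u k (b + c * t) - a t * g (b + c * t))
      = A\<^sup>2 / \<bar>c\<bar> * energy (\<lambda>t. u k t - g t)" for k
    using energy_affine[OF \<open>c \<noteq> 0\<close>, of "\<lambda>t. u k t - g t" b]
    by (simp add: A norm_mult power_mult_distrib flip: right_diff_distrib)
  moreover have "(\<lambda>k. A\<^sup>2 / \<bar>c\<bar> * energy (\<lambda>t. u k t - g t)) \<longlonglongrightarrow> 0"
    using lim by (intro tendsto_mult_right_zero) (simp add: L2_tendsto_def)
  ultimately show ?thesis
    using lim sq by (simp add: L2_tendsto_def)
qed

text \<open>
  The usual proof of the Riesz--Fischer theorem, for sequences that are Cauchy at a geometric rate. The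
  rate makes the increments summable at almost every point, so that the pointwise limit exists without
  passing to a subsequence; Fatou's lemma carries the bounds over to the limit.
\<close>

lemma L2_complete_fast:
  assumes u: "\<And>k. square_integrable (u k)"
    and close: "\<And>k m. k \<le> m \<Longrightarrow> energy (\<lambda>t. u k t - u m t) \<le> (1/4) ^ k"
  obtains g where "L2_tendsto u g"
proof -
  note [measurable] = u[THEN square_integrable_measurable]
  define d where "d k t = cmod (u k t - u (Suc k) t)" for k t
  have [measurable]: "d k \<in> borel_measurable borel" for k
    unfolding d_def by measurable
  \<comment> \<open>The weight \<open>2 ^ k\<close> is small against the decay \<open>(1/4) ^ k\<close>, yet large enough to make the \<open>d k t\<close> themselves summable.\<close>
  have "(\<integral>\<^sup>+t. (\<Sum>k. ennreal (2 ^ k * (d k t)\<^sup>2)) \<partial>lborel)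
      = (\<Sum>k. \<integral>\<^sup>+t. ennreal (2 ^ k * (d k t)\<^sup>2) \<partial>lborel)"
    by (rule nn_integral_suminf) simp
  also have "\<dots> \<le> (\<Sum>k. ennreal ((1/2) ^ k))"
  proof (intro suminf_le)
    show "(\<integral>\<^sup>+t. ennreal (2 ^ k * (d k t)\<^sup>2) \<partial>lborel) \<le> ennreal ((1/2) ^ k)" for k
    proof -
      have "(\<integral>\<^sup>+t. ennreal (2 ^ k * (d k t)\<^sup>2) \<partial>lborel)
          = ennreal (2 ^ k) * (\<integral>\<^sup>+t. ennreal ((cmod (u k t - u (Suc k) t))\<^sup>2) \<partial>lborel)"
        by (subst nn_integral_cmult[symmetric]) (auto simp: d_def ennreal_mult)
      also have "\<dots> = ennreal (2 ^ k * energy (\<lambda>t. u k t - u (Suc k) t))"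
        by (simp add: nn_integral_energy[OF square_integrable_diff(1)[OF u u]] ennreal_mult)
      also have "\<dots> \<le> ennreal (2 ^ k * (1/4) ^ k)"
        using close[of k "Suc k"] by (intro ennreal_leI mult_left_mono) auto
      also have "2 ^ k * (1/4) ^ k = (1/2 :: real) ^ k"
        by (simp flip: power_mult_distrib)
      finally show ?thesis .
    qed
  qed auto
  also have "\<dots> < \<infinity>"
    by (subst suminf_ennreal2) (auto simp: summable_geometric)
  finally have "AE t in lborel. (\<Sum>k. ennreal (2 ^ k * (d k t)\<^sup>2)) \<noteq> \<infinity>"
    by (intro nn_integral_PInf_AE) auto
  then have conv: "AE t in lborel. (\<lambda>k. u k t) \<longlonglongrightarrow> lim (\<lambda>k. u k t)"
  proof eventually_elim
    case (elim t)
    have s1: "summable (\<lambda>k. 2 ^ k * (d k t)\<^sup>2)"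
      using elim by (intro summable_suminf_not_top) (auto simp: d_def)
    have "summable (\<lambda>k. (1/2) ^ k + 2 ^ k * (d k t)\<^sup>2)"
      by (intro summable_add s1 summable_geometric) auto
    \<comment> \<open>Either \<open>d k t\<close> is at most \<open>(1/2) ^ k\<close>, or it is at most \<open>2 ^ k * (d k t)\<^sup>2\<close>.\<close>
    moreover have "d k t \<le> (1/2) ^ k + 2 ^ k * (d k t)\<^sup>2" for k
    proof (cases "d k t \<le> (1/2) ^ k")
      case False
      then have "1 \<le> 2 ^ k * d k t"
        by (simp add: field_simps)
      then have "d k t * 1 \<le> d k t * (2 ^ k * d k t)"
        by (intro mult_left_mono) (auto simp: d_def)
      then show ?thesis
        by (simp add: power2_eq_square algebra_simps add_increasing)
    qed (simp add: add_increasing2)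
    ultimately have "summable (\<lambda>k. d k t)"
      by (intro summable_comparison_test'[where N=0 and f = "\<lambda>k. d k t"]) (auto simp: d_def)
    then have "summable (\<lambda>k. u (Suc k) t - u k t)"
      by (intro summable_norm_cancel[of "\<lambda>k. u (Suc k) t - u k t"]) (simp add: d_def norm_minus_commute)
    then have "convergent (\<lambda>k. u k t)"
      by (simp add: summable_iff_convergent sum_lessThan_telescope[of "\<lambda>k. u k t"]
          convergent_diff_const_right_iff)
    then show ?case
      by (simp add: convergent_LIMSEQ_iff)
  qed
  define g where "g t = lim (\<lambda>k. u k t)" for t
  have [measurable]: "g \<in> borel_measurable borel"
    unfolding g_def by measurable
  have fatou: "(\<integral>\<^sup>+t. ennreal ((cmod (u k t - g t))\<^sup>2) \<partial>lborel) \<le> ennreal ((1/4) ^ k)" for k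
  proof -
    have "(\<integral>\<^sup>+t. ennreal ((cmod (u k t - g t))\<^sup>2) \<partial>lborel)
        = (\<integral>\<^sup>+t. liminf (\<lambda>m. ennreal ((cmod (u k t - u m t))\<^sup>2)) \<partial>lborel)"
    proof (rule nn_integral_cong_AE)
      show "AE t in lborel. ennreal ((cmod (u k t - g t))\<^sup>2) = liminf (\<lambda>m. ennreal ((cmod (u k t - u m t))\<^sup>2))"
        using conv
      proof eventually_elim
        case (elim t)
        then have "(\<lambda>m. ennreal ((cmod (u k t - u m t))\<^sup>2)) \<longlonglongrightarrow> ennreal ((cmod (u k t - g t))\<^sup>2)"
          unfolding g_def by (intro tendsto_intros tendsto_ennrealI)
        then show ?case
          by (rule lim_imp_Liminf[symmetric, rotated]) simp
      qed
    qed
    also have "\<dots> \<le> liminf (\<lambda>m. \<integral>\<^sup>+t. ennreal ((cmod (u k t - u m t))\<^sup>2) \<partial>lborel)"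
      by (intro nn_integral_liminf) measurable
    also have "\<dots> \<le> ennreal ((1/4) ^ k)"
    proof -
      have "eventually (\<lambda>m. (\<integral>\<^sup>+t. ennreal ((cmod (u k t - u m t))\<^sup>2) \<partial>lborel) \<le> ennreal ((1/4) ^ k)) sequentially"
        using eventually_ge_at_top[of k]
        by eventually_elim (simp add: nn_integral_energy[OF square_integrable_diff(1)[OF u u]] close ennreal_leI)
      then have "liminf (\<lambda>m. \<integral>\<^sup>+t. ennreal ((cmod (u k t - u m t))\<^sup>2) \<partial>lborel) \<le> liminf (\<lambda>m::nat. ennreal ((1/4) ^ k))"
        by (rule Liminf_mono)
      then show ?thesis by (simp add: Liminf_const)
    qed
    finally show ?thesis .
  qed
  have diff: "square_integrable (\<lambda>t. u k t - g t)" "energy (\<lambda>t. u k t - g t) \<le> (1/4) ^ k" for k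
    by (rule square_integrable_nn_integral_le[OF _ fatou]; simp)+
  have "square_integrable (\<lambda>t. u 0 t - (u 0 t - g t))"
    by (intro square_integrable_diff u diff)
  then have "square_integrable g" by simp
  moreover have "(\<lambda>k. energy (\<lambda>t. u k t - g t)) \<longlonglongrightarrow> 0"
    by (rule tendsto_sandwich[OF _ _ tendsto_const LIMSEQ_realpow_zero[of "1/4"]])
       (auto intro!: always_eventually diff integral_nonneg_AE)
  ultimately show ?thesis
    using that u by (auto simp: L2_tendsto_def)
qed

section \<open>Continuity of translation in the mean\<close>

abbreviation L1_modulus :: "(real \<Rightarrow> complex) \<Rightarrow> real \<Rightarrow> real" where
  "L1_modulus u h \<equiv> LINT x|lborel. cmod (u (x + h) - u x)"

lemma integrable_translate:
  fixes u :: "real \<Rightarrow> 'a::{banach, second_countable_topology}"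
  shows "integrable lborel u \<Longrightarrow> integrable lborel (\<lambda>x. u (x + h))"
  using lborel_integrable_real_affine[of u 1 h] by (simp add: add.commute)

lemma integral_translate:
  fixes u :: "real \<Rightarrow> 'a::{banach, second_countable_topology}"
  shows "(LINT x|lborel. u (x + h)) = (LINT x|lborel. u x)"
  using lborel_integral_real_affine[of 1 u h] by (simp add: add.commute)

lemma L1_modulus_add_le:
  assumes u: "integrable lborel u" and w: "integrable lborel w"
  shows "L1_modulus (\<lambda>x. u x + w x) h \<le> L1_modulus u h + L1_modulus w h"
proof -
  have "L1_modulus (\<lambda>x. u x + w x) h
      \<le> (LINT x|lborel. cmod (u (x + h) - u x) + cmod (w (x + h) - w x))"
    by (intro integral_mono')
       (auto intro!: Bochner_Integration.integrable_add integrable_norm Bochner_Integration.integrable_diff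
         integrable_translate u w simp: add_diff_add norm_triangle_ineq)
  also have "\<dots> = L1_modulus u h + L1_modulus w h"
    by (intro Bochner_Integration.integral_add integrable_norm Bochner_Integration.integrable_diff
      integrable_translate u w)
  finally show ?thesis .
qed

lemma L1_modulus_le:
  assumes u: "integrable lborel u"
  shows "L1_modulus u h \<le> 2 * (LINT x|lborel. cmod (u x))"
proof -
  have "L1_modulus u h \<le> (LINT x|lborel. cmod (u (x + h)) + cmod (u x))"
    by (intro integral_mono')
       (auto intro!: Bochner_Integration.integrable_add integrable_norm
         integrable_translate u norm_triangle_ineq4)
  also have "\<dots> = (LINT x|lborel. cmod (u (x + h))) + (LINT x|lborel. cmod (u x))"
    by (intro Bochner_Integration.integral_add integrable_norm integrable_translate u)
  finally show ?thesis
    using integral_translate[of "\<lambda>x. cmod (u x)" h] by simp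
qed

text \<open>
  Functions with continuous translations are closed in \<open>L\<^sup>1\<close>, since the modulus of \<open>u - w\<close> is at most twice
  its norm.
\<close>

lemma L1_translation_continuous_approx:
  assumes u: "integrable lborel u"
    and approx: "\<And>e. 0 < e \<Longrightarrow> \<exists>w. integrable lborel w \<and>
        (LINT x|lborel. cmod (u x - w x)) \<le> e \<and> (\<lambda>n. L1_modulus w (y n)) \<longlonglongrightarrow> 0"
  shows "(\<lambda>n. L1_modulus u (y n)) \<longlonglongrightarrow> 0"
proof (rule LIMSEQ_I)
  fix r :: real assume "0 < r"
  then obtain w where w: "integrable lborel w" "(LINT x|lborel. cmod (u x - w x)) \<le> r / 4"
    and lim: "(\<lambda>n. L1_modulus w (y n)) \<longlonglongrightarrow> 0"
    using approx[of "r / 4"] by auto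
  obtain N where N: "\<And>n. N \<le> n \<Longrightarrow> L1_modulus w (y n) < r / 2"
    using LIMSEQ_D[OF lim, of "r / 2"] \<open>0 < r\<close> by (auto simp: abs_less_iff)
  have "norm (L1_modulus u (y n) - 0) < r" if "N \<le> n" for n
  proof -
    have "L1_modulus (\<lambda>x. (u x - w x) + w x) (y n)
        \<le> L1_modulus (\<lambda>x. u x - w x) (y n) + L1_modulus w (y n)"
      by (intro L1_modulus_add_le Bochner_Integration.integrable_diff u w)
    also have "L1_modulus (\<lambda>x. u x - w x) (y n) \<le> 2 * (LINT x|lborel. cmod (u x - w x))"
      by (intro L1_modulus_le Bochner_Integration.integrable_diff u w)
    finally have "L1_modulus u (y n) < r"
      using w(2) N[OF that] by simp
    then show ?thesis
      by (simp add: integral_nonneg_AE)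
  qed
  then show "\<exists>N. \<forall>n\<ge>N. norm (L1_modulus u (y n) - 0) < r"
    by blast
qed

text \<open>
  An open set \<open>U\<close> and its translate have the same measure, so the measure of their symmetric difference
  is twice the measure of the part of \<open>U\<close> that the translation loses. Each point of \<open>U\<close> is lost
  for finitely many \<open>n\<close> only, because \<open>U\<close> is open.
\<close>

lemma L1_translation_continuous_open:
  fixes U :: "real set" and c :: complex
  assumes U: "open U" "emeasure lborel U < \<infinity>" and y: "y \<longlonglongrightarrow> (0::real)"
  shows "(\<lambda>n. L1_modulus (\<lambda>x. indicator U x *\<^sub>R c) (y n)) \<longlonglongrightarrow> 0"
proof -
  have [measurable]: "U \<in> sets borel"
    using U by simp
  let ?i = "indicator U :: real \<Rightarrow> real"
  have i: "integrable lborel ?i"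
    using U by (intro integrable_real_indicator) auto
  have loss: "integrable lborel (\<lambda>x. ?i x * (1 - ?i (x + h)))" for h
    by (rule Bochner_Integration.integrable_bound[OF i]) (auto simp: indicator_def)
  \<comment> \<open>For indicator values, \<open>\<bar>a - b\<bar> = (a - b) + 2 * b * (1 - a)\<close>, and \<open>a - b\<close> integrates to zero.\<close>
  have eq: "L1_modulus (\<lambda>x. ?i x *\<^sub>R c) h = cmod c * (2 * (LINT x|lborel. ?i x * (1 - ?i (x + h))))" for h
  proof -
    have "L1_modulus (\<lambda>x. ?i x *\<^sub>R c) h
        = (LINT x|lborel. cmod c * ((?i (x + h) - ?i x) + 2 * (?i x * (1 - ?i (x + h)))))"
      by (intro Bochner_Integration.integral_cong) (auto simp: indicator_def)
    also have "\<dots> = cmod c * ((LINT x|lborel. ?i (x + h)) - (LINT x|lborel. ?i x)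
        + 2 * (LINT x|lborel. ?i x * (1 - ?i (x + h))))"
      using i loss integrable_translate[OF i, of h] by simp
    finally show ?thesis
      by (simp add: integral_translate[of ?i h])
  qed
  have "(\<lambda>n. LINT x|lborel. ?i x * (1 - ?i (x + y n))) \<longlonglongrightarrow> (LINT x::real|lborel. (0::real))"
  proof (rule integral_dominated_convergence[where w = ?i])
    show "AE x in lborel. (\<lambda>n. ?i x * (1 - ?i (x + y n))) \<longlonglongrightarrow> 0"
    proof (intro AE_I2)
      fix x
      show "(\<lambda>n. ?i x * (1 - ?i (x + y n))) \<longlonglongrightarrow> 0"
      proof (cases "x \<in> U")
        case True
        have "(\<lambda>n. x + y n) \<longlonglongrightarrow> x + 0"
          by (intro tendsto_intros y)
        with U(1) True have "eventually (\<lambda>n. x + y n \<in> U) sequentially"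
          by (auto simp: tendsto_def)
        then have "eventually (\<lambda>n. ?i x * (1 - ?i (x + y n)) = 0) sequentially"
          by eventually_elim simp
        then show ?thesis
          by (rule tendsto_eventually)
      qed simp
    qed
  qed (use i in \<open>auto simp: indicator_def\<close>)
  then show ?thesis
    unfolding eq by (auto intro!: tendsto_eq_intros)
qed

text \<open>
  Outer regularity reduces indicators of Borel sets to indicators of open sets; linear combinations
  and dominated limits give all integrable functions.
\<close>

lemma L1_translation_continuous:
  fixes u :: "real \<Rightarrow> complex"
  assumes "integrable lborel u" and y: "y \<longlonglongrightarrow> (0::real)"
  shows "(\<lambda>n. L1_modulus u (y n)) \<longlonglongrightarrow> 0"
  using assms(1)
proof (induction u rule: integrable_induct)
  case (base A c)
  then have [measurable]: "A \<in> sets borel"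
    by simp
  show ?case
  proof (rule L1_translation_continuous_approx)
    show "integrable lborel (\<lambda>x. indicat_real A x *\<^sub>R c)"
      using base by simp
  next
    fix e :: real assume "0 < e"
    define d where "d = e / (cmod c + 1)"
    have "0 < cmod c + 1"
      by (rule add_nonneg_pos) auto
    then have "0 < d" "cmod c * d \<le> e"
      using \<open>0 < e\<close> by (simp_all add: d_def field_simps)
    obtain U where U: "open U" "A \<subseteq> U" "emeasure lborel (U - A) < ennreal d"
      using outer_regular_lborel[of A d] \<open>0 < d\<close> by auto
    have [measurable]: "U \<in> sets borel"
      using U by simp
    have fin: "emeasure lborel (U - A) < \<infinity>"
      using U(3) by (rule less_trans) simp
    have "emeasure lborel U = emeasure lborel (A \<union> (U - A))"
      using U(2) by (intro arg_cong[where f = "emeasure lborel"]) auto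
    also have "\<dots> \<le> emeasure lborel A + emeasure lborel (U - A)"
      by (intro emeasure_subadditive) auto
    also have "\<dots> < \<infinity>"
      using base(2) fin by simp
    finally have finU: "emeasure lborel U < \<infinity>" .
    have "(LINT x|lborel. cmod (indicat_real A x *\<^sub>R c - indicat_real U x *\<^sub>R c))
        = (LINT x|lborel. cmod c * indicat_real (U - A) x)"
      using U(2) by (intro Bochner_Integration.integral_cong) (auto simp: indicator_def)
    also have "\<dots> = cmod c * measure lborel (U - A)"
      by simp
    also have "\<dots> \<le> cmod c * d"
      using U(3) \<open>0 < d\<close> fin
      by (intro mult_left_mono) (auto simp: emeasure_eq_ennreal_measure ennreal_less_iff)
    also note \<open>cmod c * d \<le> e\<close>
    finally show "\<exists>w. integrable lborel w \<and>
        (LINT x|lborel. cmod (indicat_real A x *\<^sub>R c - w x)) \<le> e \<and> (\<lambda>n. L1_modulus w (y n)) \<longlonglongrightarrow> 0"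
      using finU L1_translation_continuous_open[OF U(1) finU y, of c]
      by (intro exI[of _ "\<lambda>x. indicat_real U x *\<^sub>R c"]) simp
  qed
next
  case (add u w)
  show ?case
  proof (rule tendsto_sandwich[OF _ _ tendsto_const])
    show "(\<lambda>n. L1_modulus u (y n) + L1_modulus w (y n)) \<longlonglongrightarrow> 0"
      using add by (auto intro: tendsto_eq_intros)
  qed (use add in \<open>auto intro!: always_eventually L1_modulus_add_le integral_nonneg_AE\<close>)
next
  case (lim u s)
  show ?case
  proof (rule L1_translation_continuous_approx)
    show "integrable lborel u" by fact
  next
    fix e :: real assume "0 < e"
    note [measurable] = lim.hyps(1,4)[THEN borel_measurable_integrable]
    have I: "integrable lborel (\<lambda>x. 3 * cmod (u x))"
      using lim.hyps(4) by simp
    have "(\<lambda>i. LINT x|lborel. cmod (u x - s i x)) \<longlonglongrightarrow> (LINT x::real|lborel. (0::real))"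
    proof (rule integral_dominated_convergence[where w = "\<lambda>x. 3 * cmod (u x)"])
      show "AE x in lborel. (\<lambda>i. cmod (u x - s i x)) \<longlonglongrightarrow> 0"
        using lim.hyps(2) by (intro AE_I2 tendsto_norm_zero) (auto intro!: tendsto_eq_intros)
      show "AE x in lborel. norm (cmod (u x - s i x)) \<le> 3 * cmod (u x)" for i
        using lim.hyps(3)[of _ i] norm_triangle_ineq4[of "u _" "s i _"]
        by (intro AE_I2) (auto intro: order_trans[OF norm_triangle_ineq4])
    qed (use I in auto)
    from LIMSEQ_D[OF this \<open>0 < e\<close>] obtain i where "(LINT x|lborel. cmod (u x - s i x)) \<le> e"
      by (auto simp: abs_less_iff intro: less_imp_le)
    then show "\<exists>w. integrable lborel w \<and>
        (LINT x|lborel. cmod (u x - w x)) \<le> e \<and> (\<lambda>n. L1_modulus w (y n)) \<longlonglongrightarrow> 0"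
      using lim.hyps(1) lim.IH by blast
  qed
qed

text \<open>
  The map sending \<open>a\<close> to \<open>\<bar>a\<bar> * a\<close> turns \<open>L\<^sup>2\<close> functions into \<open>L\<^sup>1\<close> functions, and this inequality says that its inverse is
  Hoelder continuous of order \<open>1/2\<close>. It holds because the map is strongly monotone:
  with \<open>D = \<bar>a\<bar> * a - \<bar>b\<bar> * b\<close>, the real inner product of \<open>D\<close> with \<open>a - b\<close> is at least
  \<open>(\<bar>a\<bar> + \<bar>b\<bar>) * \<bar>a - b\<bar>\<^sup>2 / 2\<close>.
\<close>

lemma cmod_diff_square_le_weighted:
  fixes a b :: complex
  shows "(cmod (a - b))\<^sup>2 \<le> 2 * cmod (of_real (cmod a) * a - of_real (cmod b) * b)"
proof -
  define p q r where "p = cmod a" and "q = cmod b" and "r = a \<bullet> b"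
  define D where "D = of_real (cmod a) * a - of_real (cmod b) * b"
  have sq: "(cmod (a - b))\<^sup>2 = p\<^sup>2 + q\<^sup>2 - 2 * r"
    unfolding p_def q_def r_def power2_norm_eq_inner
    by (simp add: inner_diff_left inner_diff_right inner_commute)
  have D': "D = p *\<^sub>R a - q *\<^sub>R b"
    by (simp add: D_def p_def q_def scaleR_conv_of_real)
  have "D \<bullet> (a - b) = p * p\<^sup>2 + q * q\<^sup>2 - (p + q) * r"
    unfolding D' p_def q_def r_def power2_norm_eq_inner
    by (simp add: inner_diff_left inner_diff_right inner_commute algebra_simps)
  also have "\<dots> = (p + q) * (cmod (a - b))\<^sup>2 / 2 + (p + q) * (p - q)\<^sup>2 / 2"
    unfolding sq by (simp add: power2_eq_square field_simps)
  finally have "(p + q) * (cmod (a - b))\<^sup>2 / 2 \<le> D \<bullet> (a - b)"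
    by (simp add: p_def q_def)
  also have "\<dots> \<le> cmod D * cmod (a - b)"
    by (rule norm_cauchy_schwarz)
  finally have le: "(p + q) * (cmod (a - b))\<^sup>2 \<le> 2 * cmod D * cmod (a - b)"
    by simp
  have tri: "cmod (a - b) \<le> p + q"
    unfolding p_def q_def by (rule norm_triangle_ineq4)
  show ?thesis
  proof (cases "a = b")
    case False
    have "cmod (a - b) * (cmod (a - b))\<^sup>2 \<le> (p + q) * (cmod (a - b))\<^sup>2"
      by (intro mult_right_mono tri) auto
    with le have "cmod (a - b) * (cmod (a - b))\<^sup>2 \<le> cmod (a - b) * (2 * cmod D)"
      by (simp add: mult_ac)
    with False show ?thesis
      by (simp add: D_def mult_le_cancel_left)
  qed simp
qed

text \<open>
  The preceding inequality transfers continuity of translation from the integrable function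
  \<open>\<bar>v\<bar> * v\<close> to \<open>v\<close>.
\<close>

lemma L2_translation_continuous:
  assumes v: "square_integrable v" and y: "y \<longlonglongrightarrow> (0::real)"
  shows "(\<lambda>n. energy (\<lambda>x. v (x + y n) - v x)) \<longlonglongrightarrow> 0"
proof -
  note [measurable] = square_integrable_measurable[OF v]
  define u where "u x = of_real (cmod (v x)) * v x" for x
  have u: "integrable lborel u"
    by (rule Bochner_Integration.integrable_bound[OF square_integrable_integrable[OF v]])
       (simp_all add: u_def[abs_def] norm_mult power2_eq_square)
  have shift: "integrable lborel (\<lambda>x. u (x + h))" for h
    using lborel_integrable_real_affine[OF u, of 1 h] by (simp add: add.commute)
  have lim: "(\<lambda>n. 2 * L1_modulus u (y n)) \<longlonglongrightarrow> 0"
    by (rule tendsto_mult_right_zero) (rule L1_translation_continuous[OF u y])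
  show ?thesis
  proof (rule tendsto_sandwich[OF _ _ tendsto_const lim])
    show "\<forall>\<^sub>F n in sequentially. energy (\<lambda>x. v (x + y n) - v x) \<le> 2 * (LINT x|lborel. cmod (u (x + y n) - u x))"
    proof (intro always_eventually allI)
      fix n
      have "energy (\<lambda>x. v (x + y n) - v x) \<le> (LINT x|lborel. 2 * cmod (u (x + y n) - u x))"
        using shift u
        by (intro integral_mono' Bochner_Integration.integrable_diff integrable_norm integrable_mult_right)
           (simp_all add: u_def[abs_def] cmod_diff_square_le_weighted)
      then show "energy (\<lambda>x. v (x + y n) - v x) \<le> 2 * (LINT x|lborel. cmod (u (x + y n) - u x))"
        by simp
    qed
  qed (auto intro!: integral_nonneg_AE)
qed

section \<open>Gaussian averages\<close>

text \<open>
  The convolution of \<open>v\<close> with the centred normal density of standard deviation \<open>\<bar>d\<bar>\<close>, written as an average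
  over the standard normal law so that the limit \<open>d \<rightarrow> 0\<close> only moves the argument of \<open>v\<close>.
\<close>

definition gauss_smooth :: "real \<Rightarrow> (real \<Rightarrow> complex) \<Rightarrow> real \<Rightarrow> complex" where
  "gauss_smooth d v x = (LINT w|lborel. of_real (std_normal_density w) * v (x - d * w))"

lemma integrable_std_normal_density: "integrable lborel std_normal_density"
  by simp

lemma square_integrable_std_normal_density:
  "square_integrable (\<lambda>w. of_real (std_normal_density w))"
proof (rule square_integrable_bound[OF integrable_std_normal_density])
  fix w :: real
  have "sqrt (2 * pi) \<ge> 1"
    using pi_gt3 by simp
  then have "std_normal_density w \<le> 1"
    unfolding std_normal_density_def by (intro mult_le_one) auto
  then have "std_normal_density w * std_normal_density w \<le> 1 * std_normal_density w"
    by (intro mult_right_mono) auto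
  then show "(cmod (complex_of_real (std_normal_density w)))\<^sup>2 \<le> std_normal_density w"
    by (simp add: power2_eq_square)
qed simp

lemma gauss_smooth_measurable [measurable]:
  assumes [measurable]: "v \<in> borel_measurable borel"
  shows "gauss_smooth d v \<in> borel_measurable borel"
  unfolding gauss_smooth_def[abs_def] by measurable

text \<open>
  The difference is the average of \<open>v (x - d * w) - v x\<close> over the normal law, and the square of a
  mean is at most the mean of the squares. The bound is kept in \<open>ennreal\<close> so that it can be integrated over \<open>x\<close>
  by Tonelli's theorem.
\<close>

lemma gauss_smooth_diff_le:
  assumes v: "square_integrable v" and d: "d \<noteq> 0"
  shows "ennreal ((cmod (gauss_smooth d v x - v x))\<^sup>2)
    \<le> (\<integral>\<^sup>+w. ennreal (std_normal_density w * (cmod (v (x - d * w) - v x))\<^sup>2) \<partial>lborel)"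
proof -
  note [measurable] = square_integrable_measurable[OF v]
  let ?p = std_normal_density
  have i: "integrable lborel (\<lambda>w. of_real (?p w) * v (x - d * w))"
    using square_integrable_affine[OF v, of "- d" x] d
    by (intro integrable_mult_square_integrable square_integrable_std_normal_density) simp
  have c: "integrable lborel (\<lambda>w. of_real (?p w) * v x)"
    by (intro integrable_mult_left integrable_of_real integrable_std_normal_density)
  have I: "integrable lborel (\<lambda>w. of_real (?p w) * (v (x - d * w) - v x))"
    unfolding right_diff_distrib by (intro Bochner_Integration.integrable_diff i c)
  have "gauss_smooth d v x - v x = (LINT w|lborel. of_real (?p w) * (v (x - d * w) - v x))"
    unfolding right_diff_distrib gauss_smooth_def
    by (subst Bochner_Integration.integral_diff[OF i c]) simp
  \<comment> \<open>The density is split into two square roots: Cauchy--Schwarz is used for the factors \<open>sqrt p\<close> and \<open>sqrt p * \<bar>v (x - d * w) - v x\<bar>\<close>.\<close>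
  then have "ennreal (cmod (gauss_smooth d v x - v x))
      \<le> (\<integral>\<^sup>+w. ennreal (sqrt (?p w)) * ennreal (sqrt (?p w) * cmod (v (x - d * w) - v x)) \<partial>lborel)"
    using integral_norm_bound_ennreal[OF I]
    by (simp add: norm_mult mult.assoc[symmetric] flip: ennreal_mult')
  then have "ennreal (cmod (gauss_smooth d v x - v x)) ^ 2
      \<le> (\<integral>\<^sup>+w. ennreal (sqrt (?p w)) * ennreal (sqrt (?p w) * cmod (v (x - d * w) - v x)) \<partial>lborel)\<^sup>2"
    by (intro power_mono) auto
  also have "\<dots> \<le> (\<integral>\<^sup>+w. (ennreal (sqrt (?p w)))\<^sup>2 \<partial>lborel) *
      (\<integral>\<^sup>+w. (ennreal (sqrt (?p w) * cmod (v (x - d * w) - v x)))\<^sup>2 \<partial>lborel)"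
    by (intro Cauchy_Schwarz_nn_integral) measurable
  also have "(\<integral>\<^sup>+w. (ennreal (sqrt (?p w)))\<^sup>2 \<partial>lborel) = 1"
    by (simp add: ennreal_power nn_integral_eq_integral[OF integrable_std_normal_density])
  finally show ?thesis
    by (simp add: ennreal_power power_mult_distrib)
qed

text \<open>
  After exchanging the integrals, the squared error is at most the normal average of the squared
  \<open>L\<^sup>2\<close> moduli of continuity of \<open>v\<close> at \<open>- d * w\<close>. These tend to \<open>0\<close> for every \<open>w\<close> and never exceed four times the energy
  of \<open>v\<close>.
\<close>

lemma gauss_smooth_L2_tendsto:
  assumes v: "square_integrable v" and d: "d \<longlonglongrightarrow> 0" "\<And>k::nat. d k \<noteq> (0::real)"
  shows "L2_tendsto (\<lambda>k. gauss_smooth (d k) v) v"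
proof -
  note [measurable] = square_integrable_measurable[OF v]
  let ?p = std_normal_density
  let ?E = "\<lambda>k w. ?p w * energy (\<lambda>x. v (x + - d k * w) - v x)"
  have sh: "square_integrable (\<lambda>x. v (x + h) - v x)" for h
    using square_integrable_affine[OF v, of 1 h] by (intro square_integrable_diff v) (simp add: add.commute)
  have bound: "energy (\<lambda>x. v (x + h) - v x) \<le> 4 * energy v" for h
    using energy_diff_le[of "\<lambda>x. v (x + h)" v] square_integrable_affine[OF v, of 1 h]
      energy_affine[of 1 v h] v
    by (simp add: add.commute)
  have meas: "(\<lambda>w. ?E k w) \<in> borel_measurable lborel" for k
    by measurable
  have int: "integrable lborel (?E k)" for k
    by (rule Bochner_Integration.integrable_bound[of _ "\<lambda>w. ?p w * (4 * energy v)"])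
       (use meas bound[of "- d k * _"] in \<open>auto intro!: AE_I2 mult_left_mono simp: abs_mult integral_nonneg_AE\<close>)
  have le: "(\<integral>\<^sup>+x. ennreal ((cmod (gauss_smooth (d k) v x - v x))\<^sup>2) \<partial>lborel)
      \<le> ennreal (LINT w|lborel. ?E k w)" for k
  proof -
    have "(\<integral>\<^sup>+x. ennreal ((cmod (gauss_smooth (d k) v x - v x))\<^sup>2) \<partial>lborel)
        \<le> (\<integral>\<^sup>+x. \<integral>\<^sup>+w. ennreal (?p w * (cmod (v (x - d k * w) - v x))\<^sup>2) \<partial>lborel \<partial>lborel)"
      by (intro nn_integral_mono gauss_smooth_diff_le v d)
    also have "\<dots> = (\<integral>\<^sup>+w. \<integral>\<^sup>+x. ennreal (?p w * (cmod (v (x - d k * w) - v x))\<^sup>2) \<partial>lborel \<partial>lborel)"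
      by (intro lborel_pair.Fubini') measurable
    also have "\<dots> = (\<integral>\<^sup>+w. ennreal (?E k w) \<partial>lborel)"
    proof (intro nn_integral_cong)
      fix w
      show "(\<integral>\<^sup>+x. ennreal (?p w * (cmod (v (x - d k * w) - v x))\<^sup>2) \<partial>lborel) = ennreal (?E k w)"
        using nn_integral_energy[OF sh, of "- d k * w"]
        by (simp add: ennreal_mult' nn_integral_cmult)
    qed
    also have "\<dots> = ennreal (LINT w|lborel. ?E k w)"
      by (intro nn_integral_eq_integral int) (auto intro!: mult_nonneg_nonneg integral_nonneg_AE)
    finally show ?thesis .
  qed
  have nn: "0 \<le> (LINT w|lborel. ?E k w)" for k
    by (auto intro!: mult_nonneg_nonneg integral_nonneg_AE)
  have sq: "square_integrable (\<lambda>x. gauss_smooth (d k) v x - v x)"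
      "energy (\<lambda>x. gauss_smooth (d k) v x - v x) \<le> (LINT w|lborel. ?E k w)" for k
    by (rule square_integrable_nn_integral_le[OF _ le nn]; measurable)+
  have "(\<lambda>k. LINT w|lborel. ?E k w) \<longlonglongrightarrow> (LINT w::real|lborel. 0)"
  proof (rule integral_dominated_convergence[where w = "\<lambda>w. ?p w * (4 * energy v)"])
    show "AE w in lborel. (\<lambda>k. ?E k w) \<longlonglongrightarrow> 0"
    proof (intro AE_I2 tendsto_mult_right_zero L2_translation_continuous v)
      show "(\<lambda>k. - d k * w) \<longlonglongrightarrow> 0" for w
        using d by (auto intro!: tendsto_eq_intros)
    qed
    show "AE w in lborel. norm (?E k w) \<le> ?p w * (4 * energy v)" for k
      using bound[of "- d k * _"]
      by (intro AE_I2) (auto intro!: mult_left_mono simp: abs_mult integral_nonneg_AE)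
  qed (use meas in auto)
  then have lim: "(\<lambda>k. LINT w|lborel. ?E k w) \<longlonglongrightarrow> 0"
    by simp
  have "(\<lambda>k. energy (\<lambda>x. gauss_smooth (d k) v x - v x)) \<longlonglongrightarrow> 0"
    by (rule tendsto_sandwich[OF _ _ tendsto_const lim])
       (use sq(2) in \<open>auto intro!: always_eventually integral_nonneg_AE\<close>)
  moreover have "square_integrable (gauss_smooth (d k) v)" for k
  proof -
    have "square_integrable (\<lambda>x. (gauss_smooth (d k) v x - v x) - (- 1) * v x)"
      by (intro square_integrable_diff square_integrable_cmult sq v)
    then show ?thesis by simp
  qed
  ultimately show ?thesis
    using v by (simp add: L2_tendsto_def)
qed

section \<open>Plancherel's theorem\<close>

abbreviation gauss_weight :: "real \<Rightarrow> real \<Rightarrow> complex" where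
  "gauss_weight d t \<equiv> of_real (exp (- (d * t)\<^sup>2 / 2))"

lemma integral_std_normal_exp:
  "(LINT w|lborel. of_real (std_normal_density w) * exp (\<i> * of_real w * of_real t))
     = complex_of_real (exp (- t\<^sup>2 / 2))"
proof -
  have "char std_normal_distribution t
      = (LINT w|lborel. std_normal_density w *\<^sub>R iexp (t * w))"
    unfolding char_def by (subst integral_density) auto
  then show ?thesis
    by (simp add: char_std_normal_distribution scaleR_conv_of_real mult_ac)
qed

lemma gauss_weight_conv_density:
  "gauss_weight d t = of_real (sqrt (2 * pi)) * of_real (std_normal_density (d * t))"
  by (simp only: std_normal_density_def of_real_mult[symmetric]) simp

lemma integrable_gauss_weight:
  "d \<noteq> 0 \<Longrightarrow> integrable lborel (gauss_weight d)"
  unfolding gauss_weight_conv_density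
  using lborel_integrable_real_affine[OF integrable_std_normal_density, of d 0]
  by (intro integrable_mult_right integrable_of_real) simp

text \<open>
  A Gaussian is its own Fourier transform up to scaling; the substitution \<open>t = w / d\<close> reduces this to
  the characteristic function of the standard normal distribution.
\<close>

lemma integral_gauss_weight_exp:
  assumes "d > 0"
  shows "(LINT t|lborel. gauss_weight d t * exp (\<i> * of_real t * of_real x))
    = of_real (2 * pi / d * std_normal_density (x / d))"
proof -
  have "(LINT t|lborel. gauss_weight d t * exp (\<i> * of_real t * of_real x))
      = (1 / d) *\<^sub>R (LINT w|lborel. gauss_weight 1 w * exp (\<i> * of_real w * of_real (x / d)))"
    using assms lborel_integral_real_affine[of "1 / d" "\<lambda>t. gauss_weight d t * exp (\<i> * of_real t * of_real x)" 0]
    by (simp add: field_simps)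
  also have "\<dots> = of_real (sqrt (2 * pi) / d) *
      (LINT w|lborel. of_real (std_normal_density w) * exp (\<i> * of_real w * of_real (x / d)))"
    unfolding gauss_weight_conv_density
    by (simp add: scaleR_conv_of_real mult.assoc)
  also have "\<dots> = of_real (2 * pi / d * std_normal_density (x / d))"
  proof -
    have "sqrt (2 * pi) / d * exp (- (x / d)\<^sup>2 / 2) = 2 * pi / d * std_normal_density (x / d)"
      using assms by (simp add: std_normal_density_def real_div_sqrt field_simps)
    then show ?thesis
      by (subst integral_std_normal_exp) (simp only: of_real_mult[symmetric])
  qed
  finally show ?thesis .
qed

lemma fourier_measurable [measurable]:
  assumes [measurable]: "v \<in> borel_measurable borel"
  shows "fourier v \<in> borel_measurable borel"
  unfolding fourier_def[abs_def] by measurable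

lemma fourier_bounded:
  "cmod (fourier v \<omega>) \<le> (LINT x|lborel. cmod (v x))"
  unfolding fourier_def
  by (rule order_trans[OF integral_norm_bound]) (simp add: norm_mult)

text \<open>
  Regularised Fourier inversion: the weight makes the double integral over \<open>t\<close> and the variable of \<open>v\<close> absolutely
  convergent, and carrying out the integration over \<open>t\<close> first leaves a Gaussian centred at \<open>x\<close>.
\<close>

lemma inverse_fourier_gauss_weight:
  assumes v: "integrable lborel v" and d: "d > 0"
  shows "(LINT t|lborel. fourier v t * gauss_weight d t * exp (\<i> * of_real t * of_real x))
    = 2 * of_real pi * gauss_smooth d v x"
proof -
  note [measurable] = borel_measurable_integrable[OF v]
  let ?g = "\<lambda>t y. v y * (gauss_weight d t * exp (\<i> * of_real t * of_real (x - y)))"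
  have g: "integrable (lborel \<Otimes>\<^sub>M lborel) (case_prod ?g)"
  proof (rule lborel_pair.Fubini_integrable)
    show "case_prod ?g \<in> borel_measurable (lborel \<Otimes>\<^sub>M lborel)"
      by measurable
    have "integrable lborel (\<lambda>t. (LINT y|lborel. cmod (v y)) * cmod (gauss_weight d t))"
      using d by (intro integrable_mult_right integrable_norm integrable_gauss_weight) simp
    then show "integrable lborel (\<lambda>t. LINT y|lborel. norm (case_prod ?g (t, y)))"
      by (simp add: norm_mult)
    show "AE t in lborel. integrable lborel (\<lambda>y. case_prod ?g (t, y))"
      by (intro AE_I2 Bochner_Integration.integrable_bound[OF v]) (auto simp: norm_mult mult_le_cancel_left1 intro!: mult_left_le)
  qed
  have "(LINT t|lborel. fourier v t * gauss_weight d t * exp (\<i> * of_real t * of_real x))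
      = (LINT t|lborel. LINT y|lborel. ?g t y)"
    unfolding fourier_def
    by (intro Bochner_Integration.integral_cong refl)
       (simp add: mult.assoc right_diff_distrib exp_diff exp_minus field_simps
         flip: integral_mult_left_zero integral_mult_right_zero)
  also have "\<dots> = (LINT y|lborel. LINT t|lborel. ?g t y)"
    by (rule lborel_pair.Fubini_integral[symmetric, OF g])
  also have "\<dots> = (LINT y|lborel. v y * of_real (2 * pi / d * std_normal_density ((x - y) / d)))"
    by (simp only: integral_mult_right_zero integral_gauss_weight_exp[OF d])
  also have "\<dots> = d *\<^sub>R (LINT w|lborel. v (x - d * w) * of_real (2 * pi / d * std_normal_density w))"
    using d lborel_integral_real_affine[of "- d" "\<lambda>y. v y * of_real (2 * pi / d * std_normal_density ((x - y) / d))" x]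
    by simp
  also have "\<dots> = d *\<^sub>R (of_real (2 * pi / d) * gauss_smooth d v x)"
    unfolding gauss_smooth_def
    by (subst integral_mult_right_zero[symmetric]) (simp add: mult_ac)
  also have "\<dots> = 2 * of_real pi * gauss_smooth d v x"
    using d by (simp add: scaleR_conv_of_real)
  finally show ?thesis .
qed

lemma fourier_diff:
  assumes "integrable lborel u" "integrable lborel v"
  shows "fourier (\<lambda>x. u x - v x) = (\<lambda>\<omega>. fourier u \<omega> - fourier v \<omega>)"
proof
  fix \<omega>
  have i: "integrable lborel (\<lambda>x. w x * exp (- (\<i> * of_real x * of_real \<omega>)))" if "integrable lborel w" for w
    using borel_measurable_integrable[OF that]
    by (intro Bochner_Integration.integrable_bound[OF that]) (auto simp: norm_mult)
  show "fourier (\<lambda>x. u x - v x) \<omega> = fourier u \<omega> - fourier v \<omega>"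
    unfolding fourier_def left_diff_distrib
    by (rule Bochner_Integration.integral_diff) (intro i assms)+
qed

text \<open>
  With the weight \<open>exp (- (d * t)\<^sup>2 / 2)\<close> inserted on the left, Fubini's theorem and regularised inversion
  turn the integral into \<open>2 * pi\<close> times the inner product of \<open>u\<close> with a Gaussian average of \<open>v\<close>. Both sides
  converge as \<open>d \<rightarrow> 0\<close>.
\<close>

lemma plancherel_L1_L2:
  assumes u: "integrable lborel u" "square_integrable u" "square_integrable (fourier u)"
    and v: "integrable lborel v" "square_integrable v" "square_integrable (fourier v)"
  shows "L2_inner (fourier u) (fourier v) = 2 * of_real pi * L2_inner u v"
proof -
  note [measurable] = borel_measurable_integrable[OF u(1)] borel_measurable_integrable[OF v(1)]
  define d where "d k = inverse (real (Suc k))" for k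
  have d: "d k > 0" "d \<longlonglongrightarrow> 0" for k
    unfolding d_def[abs_def] using LIMSEQ_inverse_real_of_nat by (auto simp: d_def)
  have prod: "integrable lborel (\<lambda>t. fourier u t * cnj (fourier v t))"
    by (intro integrable_mult_square_integrable square_integrable_cnj u v)
  have eq: "(LINT t|lborel. fourier u t * cnj (fourier v t) * gauss_weight (d k) t)
      = 2 * of_real pi * L2_inner u (gauss_smooth (d k) v)" for k
  proof -
    let ?w = "\<lambda>t. cnj (fourier v t) * gauss_weight (d k) t"
    let ?g = "\<lambda>t x. ?w t * (u x * exp (- (\<i> * of_real x * of_real t)))"
    have w: "integrable lborel ?w"
    proof (rule Bochner_Integration.integrable_bound)
      show "integrable lborel (\<lambda>t. (LINT x|lborel. cmod (v x)) * cmod (gauss_weight (d k) t))"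
        using d(1)[of k] by (intro integrable_mult_right integrable_norm integrable_gauss_weight) simp
    qed (auto simp: norm_mult intro!: AE_I2 order_trans[OF fourier_bounded])
    have g: "integrable (lborel \<Otimes>\<^sub>M lborel) (case_prod ?g)"
    proof (rule lborel_pair.Fubini_integrable)
      show "case_prod ?g \<in> borel_measurable (lborel \<Otimes>\<^sub>M lborel)"
        by measurable
      have "integrable lborel (\<lambda>t. cmod (?w t) * (LINT x|lborel. cmod (u x)))"
        by (intro integrable_mult_left integrable_norm w)
      then show "integrable lborel (\<lambda>t. LINT x|lborel. norm (case_prod ?g (t, x)))"
        by (simp add: norm_mult)
      show "AE t in lborel. integrable lborel (\<lambda>x. case_prod ?g (t, x))"
        unfolding split
        by (intro AE_I2 integrable_mult_right Bochner_Integration.integrable_bound[OF u(1)])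
           (auto simp: norm_mult)
    qed
    have "(LINT t|lborel. fourier u t * cnj (fourier v t) * gauss_weight (d k) t)
        = (LINT t|lborel. LINT x|lborel. ?g t x)"
    proof (intro Bochner_Integration.integral_cong refl)
      fix t
      have "(LINT x|lborel. ?g t x) = ?w t * fourier u t"
        by (simp only: fourier_def integral_mult_right_zero)
      then show "fourier u t * cnj (fourier v t) * gauss_weight (d k) t = (LINT x|lborel. ?g t x)"
        by (simp add: mult_ac)
    qed
    also have "\<dots> = (LINT x|lborel. LINT t|lborel. ?g t x)"
      by (rule lborel_pair.Fubini_integral[symmetric, OF g])
    also have "\<dots> = (LINT x|lborel. u x * cnj (LINT t|lborel. fourier v t * gauss_weight (d k) t * exp (\<i> * of_real t * of_real x)))"
    proof (intro Bochner_Integration.integral_cong refl)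
      fix x
      have "(LINT t|lborel. ?g t x) = (LINT t|lborel. u x * cnj (fourier v t * gauss_weight (d k) t * exp (\<i> * of_real t * of_real x)))"
        by (intro Bochner_Integration.integral_cong refl) (simp add: exp_cnj mult_ac)
      then show "(LINT t|lborel. ?g t x) = u x * cnj (LINT t|lborel. fourier v t * gauss_weight (d k) t * exp (\<i> * of_real t * of_real x))"
        by (simp only: integral_mult_right_zero Bochner_Integration.integral_cnj)
    qed
    also have "\<dots> = (LINT x|lborel. 2 * of_real pi * (u x * cnj (gauss_smooth (d k) v x)))"
      unfolding inverse_fourier_gauss_weight[OF v(1) d(1)] by (simp add: mult_ac)
    also have "\<dots> = 2 * of_real pi * L2_inner u (gauss_smooth (d k) v)"
      by (simp add: L2_inner_def)
    finally show ?thesis .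
  qed
  have "(\<lambda>k. LINT t|lborel. fourier u t * cnj (fourier v t) * gauss_weight (d k) t)
      \<longlonglongrightarrow> (LINT t|lborel. fourier u t * cnj (fourier v t))"
  proof (rule integral_dominated_convergence[where w = "\<lambda>t. cmod (fourier u t * cnj (fourier v t))"])
    show "AE t in lborel. (\<lambda>k. fourier u t * cnj (fourier v t) * gauss_weight (d k) t)
        \<longlonglongrightarrow> fourier u t * cnj (fourier v t)"
      using d(2) by (intro AE_I2) (auto intro!: tendsto_eq_intros)
    show "integrable lborel (\<lambda>t. cmod (fourier u t * cnj (fourier v t)))"
      by (intro integrable_norm prod)
    show "AE t in lborel. norm (fourier u t * cnj (fourier v t) * gauss_weight (d k) t)
        \<le> cmod (fourier u t * cnj (fourier v t))" for k
      by (intro AE_I2) (simp add: norm_mult mult_left_le)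
  qed measurable
  then have lim: "(\<lambda>k. 2 * of_real pi * L2_inner u (gauss_smooth (d k) v)) \<longlonglongrightarrow> L2_inner (fourier u) (fourier v)"
    unfolding eq L2_inner_def .
  have "L2_tendsto (\<lambda>k. gauss_smooth (d k) v) v"
    using d by (intro gauss_smooth_L2_tendsto v) (auto simp: less_imp_neq[symmetric])
  moreover have "L2_tendsto (\<lambda>k. u) u"
    using u by (simp add: L2_tendsto_def)
  ultimately have "(\<lambda>k. 2 * of_real pi * L2_inner u (gauss_smooth (d k) v)) \<longlonglongrightarrow> 2 * of_real pi * L2_inner u v"
    by (intro tendsto_mult tendsto_const L2_inner_tendsto)
  with lim show ?thesis
    by (rule LIMSEQ_unique)
qed

lemma energy_fourier:
  assumes "integrable lborel u" "square_integrable u" "square_integrable (fourier u)"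
  shows "energy (fourier u) = 2 * pi * energy u"
proof -
  have "complex_of_real (energy v) = L2_inner v v" for v
    unfolding L2_inner_def complex_norm_square[symmetric] integral_complex_of_real by simp
  then have "complex_of_real (energy (fourier u)) = of_real (2 * pi * energy u)"
    using plancherel_L1_L2[OF assms assms] by simp
  then show ?thesis
    by (simp only: of_real_eq_iff)
qed

text \<open>
  Both sides of Plancherel's formula for the approximating integrable functions pass to the limit.
\<close>

theorem L2_fourier_parseval:
  assumes "has_L2_fourier g h" "has_L2_fourier g' h'"
  shows "L2_inner h h' = 2 * of_real pi * L2_inner g g'"
proof -
  from assms obtain u u' where
    u: "\<And>k. integrable lborel (u k)" "L2_tendsto u g" "L2_tendsto (\<lambda>k. fourier (u k)) h" and
    u': "\<And>k. integrable lborel (u' k)" "L2_tendsto u' g'" "L2_tendsto (\<lambda>k. fourier (u' k)) h'"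
    unfolding has_L2_fourier_def by blast
  have "(\<lambda>k. L2_inner (fourier (u k)) (fourier (u' k))) \<longlonglongrightarrow> L2_inner h h'"
    by (intro L2_inner_tendsto u u')
  moreover have "(\<lambda>k. L2_inner (fourier (u k)) (fourier (u' k)))
      = (\<lambda>k. 2 * of_real pi * L2_inner (u k) (u' k))"
    using u u' by (intro ext plancherel_L1_L2) (auto simp: L2_tendsto_def)
  ultimately have "(\<lambda>k. 2 * of_real pi * L2_inner (u k) (u' k)) \<longlonglongrightarrow> L2_inner h h'"
    by simp
  moreover have "(\<lambda>k. 2 * of_real pi * L2_inner (u k) (u' k)) \<longlonglongrightarrow> 2 * of_real pi * L2_inner g g'"
    by (intro tendsto_mult tendsto_const L2_inner_tendsto u u')
  ultimately show ?thesis
    by (rule LIMSEQ_unique)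
qed

section \<open>Surjectivity of the Fourier transform\<close>

text \<open>
  Truncation makes a square integrable function integrable, so that its Fourier integral exists.
\<close>

lemma L2_tendsto_truncate:
  assumes h: "square_integrable h"
  shows "L2_tendsto (\<lambda>k t. indicator {- real k..real k} t * h t) h"
proof -
  note [measurable] = square_integrable_measurable[OF h]
  have "(\<lambda>k. energy (\<lambda>t. indicator {- real k..real k} t * h t - h t)) \<longlonglongrightarrow> (LINT t::real|lborel. 0)"
  proof (rule integral_dominated_convergence[where w = "\<lambda>t. (cmod (h t))\<^sup>2"])
    show "AE t in lborel. (\<lambda>k. (cmod (indicator {- real k..real k} t * h t - h t))\<^sup>2) \<longlonglongrightarrow> 0"
    proof (intro AE_I2 tendsto_eventually)
      fix t :: real
      have "eventually (\<lambda>k. \<bar>t\<bar> \<le> real k) sequentially"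
        using eventually_ge_at_top[of "nat \<lceil>\<bar>t\<bar>\<rceil>"] by eventually_elim linarith
      then show "eventually (\<lambda>k. (cmod (indicator {- real k..real k} t * h t - h t))\<^sup>2 = 0) sequentially"
        by eventually_elim (auto simp: indicator_def)
    qed
  qed (use square_integrable_integrable[OF h] in \<open>auto simp: indicator_def\<close>)
  moreover have "square_integrable (\<lambda>t. indicator {- real k..real k} t * h t)" for k
    by (rule square_integrable_bound[OF square_integrable_integrable[OF h]]) (auto simp: indicator_def)
  ultimately show ?thesis
    using h by (simp add: L2_tendsto_def)
qed

lemma integrable_truncate:
  assumes h: "square_integrable h"
  shows "integrable lborel (\<lambda>t. indicator {a..b} t * h t)"
proof (intro integrable_mult_square_integrable h)
  have "integrable lborel (indicat_real {a..b})"
    by (intro integrable_real_indicator) (auto simp: emeasure_lborel_Icc_eq)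
  then show "square_integrable (indicator {a..b})"
    by (rule square_integrable_bound) (auto simp: indicator_def)
qed

text \<open>
  The inverse Fourier integral of \<open>h\<close>, damped by a Gaussian, is an explicit function whose Fourier
  transform is the Gaussian average of \<open>h\<close>. The inverse integral is obtained from \<open>fourier\<close> by conjugating
  before and after.
\<close>

lemma fourier_inverse_gauss:
  assumes h: "integrable lborel h" and d: "d > 0"
  defines "u \<equiv> \<lambda>x. cnj (fourier (\<lambda>t. cnj (h t)) x) * gauss_weight d x / (2 * of_real pi)"
  shows "integrable lborel u" and "square_integrable u" and "fourier u = gauss_smooth d h"
proof -
  note [measurable] = borel_measurable_integrable[OF h]
  define M where "M = (LINT t|lborel. cmod (h t)) / (2 * pi)"
  have M: "0 \<le> M"
    unfolding M_def by (auto intro!: divide_nonneg_nonneg integral_nonneg_AE)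
  have le: "cmod (u x) \<le> M * cmod (gauss_weight d x)" for x
    using fourier_bounded[of "\<lambda>t. cnj (h t)" x]
    by (simp add: u_def M_def norm_mult norm_divide divide_right_mono mult_right_mono)
  have [measurable]: "u \<in> borel_measurable borel"
    unfolding u_def by measurable
  have gw: "integrable lborel (\<lambda>x. cmod (gauss_weight d x))"
    using d by (intro integrable_norm integrable_gauss_weight) simp
  show "integrable lborel u"
    by (rule Bochner_Integration.integrable_bound[OF integrable_mult_right[OF gw, of M]])
       (use le M in \<open>auto simp: abs_mult\<close>)
  show "square_integrable u"
  proof (rule square_integrable_bound[OF integrable_mult_right[OF gw, of "M\<^sup>2"]])
    fix x
    have "(cmod (u x))\<^sup>2 \<le> (M * cmod (gauss_weight d x))\<^sup>2"
      by (intro power_mono le) auto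
    also have "\<dots> = M\<^sup>2 * (cmod (gauss_weight d x) * cmod (gauss_weight d x))"
      by (simp add: power2_eq_square)
    also have "\<dots> \<le> M\<^sup>2 * (1 * cmod (gauss_weight d x))"
      by (intro mult_left_mono mult_right_mono) auto
    finally show "(cmod (u x))\<^sup>2 \<le> M\<^sup>2 * cmod (gauss_weight d x)"
      by simp
  qed measurable
  show "fourier u = gauss_smooth d h"
  proof
    fix \<omega>
    have "fourier u \<omega> = (LINT x|lborel. cnj (fourier (\<lambda>t. cnj (h t)) x * gauss_weight d x
        * exp (\<i> * of_real x * of_real \<omega>)) / (2 * of_real pi))"
      by (subst fourier_def) (simp add: u_def exp_cnj)
    also have "\<dots> = cnj (LINT x|lborel. fourier (\<lambda>t. cnj (h t)) x * gauss_weight d x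
        * exp (\<i> * of_real x * of_real \<omega>)) / (2 * of_real pi)"
      by (simp only: integral_divide_zero Bochner_Integration.integral_cnj)
    also have "\<dots> = cnj (gauss_smooth d (\<lambda>t. cnj (h t)) \<omega>)"
      using h d by (subst inverse_fourier_gauss_weight) auto
    also have "\<dots> = gauss_smooth d h \<omega>"
      unfolding gauss_smooth_def Bochner_Integration.integral_cnj[symmetric] by simp
    finally show "fourier u \<omega> = gauss_smooth d h \<omega>" .
  qed
qed

text \<open>
  Truncation to a bounded interval followed by Gaussian averaging. The average of an integrable function
  is a Fourier transform by the preceding lemma.
\<close>

lemma fourier_dense_L2:
  assumes h: "square_integrable h" and e: "0 < e"
  obtains u where "integrable lborel u" "square_integrable u" "square_integrable (fourier u)"
    "energy (\<lambda>t. fourier u t - h t) \<le> e"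
proof -
  obtain k where k: "energy (\<lambda>t. indicator {- real k..real k} t * h t - h t) \<le> e / 4"
    using L2_tendsto_eventually_close[OF L2_tendsto_truncate[OF h], of "e / 4"] e by auto
  define hk where "hk t = indicator {- real k..real k} t * h t" for t
  have hk: "square_integrable hk" "integrable lborel hk"
    using L2_tendsto_truncate[OF h] integrable_truncate[OF h]
    by (auto simp: L2_tendsto_def hk_def[abs_def])
  define d where "d j = inverse (real (Suc j))" for j
  have d: "d j > 0" "d \<longlonglongrightarrow> 0" for j
    unfolding d_def[abs_def] using LIMSEQ_inverse_real_of_nat by (auto simp: d_def)
  have lim: "L2_tendsto (\<lambda>j. gauss_smooth (d j) hk) hk"
    using d by (intro gauss_smooth_L2_tendsto hk) (auto simp: less_imp_neq[symmetric])
  then obtain j where j: "energy (\<lambda>t. gauss_smooth (d j) hk t - hk t) \<le> e / 4"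
    by (rule L2_tendsto_eventually_close[of _ _ "e / 4"]) (use e in auto)
  have sm: "square_integrable (gauss_smooth (d j) hk)"
    using lim by (simp add: L2_tendsto_def)
  have "energy (\<lambda>t. (gauss_smooth (d j) hk t - hk t) - (h t - hk t))
      \<le> 2 * energy (\<lambda>t. gauss_smooth (d j) hk t - hk t) + 2 * energy (\<lambda>t. h t - hk t)"
    by (intro energy_diff_le square_integrable_diff sm hk h)
  also have "energy (\<lambda>t. h t - hk t) = energy (\<lambda>t. hk t - h t)"
    by (simp add: norm_minus_commute)
  finally have "energy (\<lambda>t. gauss_smooth (d j) hk t - h t) \<le> e"
    using j k[folded hk_def] by simp
  then show ?thesis
    using fourier_inverse_gauss(3)[OF hk(2) d(1)] sm
    by (intro that[OF fourier_inverse_gauss(1,2)[OF hk(2) d(1)]]) simp_all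
qed

text \<open>
  Approximate \<open>h\<close> at a geometric rate by Fourier transforms of nice functions. By Plancherel's theorem
  these functions are Cauchy at the same rate, so they converge.
\<close>

theorem has_L2_fourier_surj:
  assumes h: "square_integrable h"
  obtains g where "has_L2_fourier g h"
proof -
  have "\<exists>u. integrable lborel u \<and> square_integrable u \<and> square_integrable (fourier u) \<and>
      energy (\<lambda>t. fourier u t - h t) \<le> (1/4) ^ k" for k :: nat
    by (rule fourier_dense_L2[OF h, of "(1/4) ^ k"]) auto
  then obtain u where u: "\<And>k. integrable lborel (u k)" "\<And>k. square_integrable (u k)"
      "\<And>k. square_integrable (fourier (u k))"
      and close: "\<And>k. energy (\<lambda>t. fourier (u k) t - h t) \<le> (1/4) ^ k"
    using choice[of "\<lambda>k u. integrable lborel u \<and> square_integrable u \<and> square_integrable (fourier u) \<and>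
      energy (\<lambda>t. fourier u t - h t) \<le> (1/4) ^ k"] by blast
  have "(\<lambda>k. energy (\<lambda>t. fourier (u k) t - h t)) \<longlonglongrightarrow> 0"
    by (rule tendsto_sandwich[OF _ _ tendsto_const LIMSEQ_realpow_zero[of "1/4"]])
       (use close in \<open>auto intro!: always_eventually integral_nonneg_AE\<close>)
  then have lim: "L2_tendsto (\<lambda>k. fourier (u k)) h"
    using u h by (simp add: L2_tendsto_def)
  have "energy (\<lambda>t. u k t - u m t) \<le> (1/4) ^ k" if "k \<le> m" for k m
  proof -
    have "2 * pi * energy (\<lambda>t. u k t - u m t) = energy (\<lambda>t. fourier (u k) t - fourier (u m) t)"
      using energy_fourier[of "\<lambda>t. u k t - u m t"] fourier_diff[OF u(1) u(1), of k m]
        square_integrable_diff[OF u(2) u(2), of k m] square_integrable_diff[OF u(3) u(3), of k m] u(1)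
      by simp
    also have "\<dots> = energy (\<lambda>t. (fourier (u k) t - h t) - (fourier (u m) t - h t))"
      by simp
    also have "\<dots> \<le> 2 * energy (\<lambda>t. fourier (u k) t - h t) + 2 * energy (\<lambda>t. fourier (u m) t - h t)"
      by (intro energy_diff_le square_integrable_diff u h)
    also have "\<dots> \<le> 2 * (1/4) ^ k + 2 * (1/4) ^ m"
      by (intro add_mono mult_left_mono close) auto
    also have "\<dots> \<le> 4 * (1/4) ^ k"
      using power_decreasing[OF that, of "1/4 :: real"] by simp
    finally have "2 * pi * energy (\<lambda>t. u k t - u m t) \<le> 4 * (1/4) ^ k" .
    \<comment> \<open>The constant \<open>4\<close> from the triangle inequality is absorbed by \<open>2 * pi\<close>.\<close>
    moreover have "4 * energy (\<lambda>t. u k t - u m t) \<le> 2 * pi * energy (\<lambda>t. u k t - u m t)"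
      using pi_gt3 by (intro mult_right_mono integral_nonneg_AE) auto
    ultimately show ?thesis by simp
  qed
  with u(2) obtain g where "L2_tendsto u g"
    by (rule L2_complete_fast)
  with u(1) lim that show ?thesis
    unfolding has_L2_fourier_def by blast
qed

lemma has_L2_fourier_inv_fourier:
  "square_integrable h \<Longrightarrow> has_L2_fourier (inv_fourier h) h"
  unfolding inv_fourier_def by (erule has_L2_fourier_surj) (rule someI[of "\<lambda>g. has_L2_fourier g h"])

section \<open>Translations and dilations under the Fourier transform\<close>

lemma translate_dilate_eq:
  "translate x (dilate s v) t = of_real (s powr (- 1/2)) * v (- (x / s) + inverse s * t)"
proof -
  have "inverse s * (t - x) = - (x / s) + inverse s * t"
    by (simp add: divide_inverse right_diff_distrib)
  then show ?thesis
    by (simp add: translate_def dilate_def)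
qed

lemma fourier_translate_dilate:
  assumes "s > 0"
  shows "fourier (translate x (dilate s v)) \<omega>
    = exp (- (\<i> * of_real x * of_real \<omega>)) * of_real (sqrt s) * fourier v (s * \<omega>)"
proof -
  have "s * s powr (- 1/2) = sqrt s"
    using assms powr_minus[of s "1/2"] by (simp add: powr_half_sqrt real_div_sqrt flip: divide_inverse)
  have "fourier (translate x (dilate s v)) \<omega>
      = s *\<^sub>R (LINT r|lborel. translate x (dilate s v) (x + s * r) * exp (- (\<i> * of_real (x + s * r) * of_real \<omega>)))"
    unfolding fourier_def
    using lborel_integral_real_affine[OF less_imp_neq[OF assms, symmetric], of
        "\<lambda>t. translate x (dilate s v) t * exp (- (\<i> * of_real t * of_real \<omega>))" x]
    by (simp only: abs_of_pos[OF assms])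
  also have "\<dots> = s *\<^sub>R (LINT r|lborel. (of_real (s powr (- 1/2)) * exp (- (\<i> * of_real x * of_real \<omega>)))
      * (v r * exp (- (\<i> * of_real r * of_real (s * \<omega>)))))"
  proof (intro arg_cong[where f = "\<lambda>c. s *\<^sub>R c"] Bochner_Integration.integral_cong refl)
    fix r
    have "exp (- (\<i> * complex_of_real (x + s * r) * of_real \<omega>))
        = exp (- (\<i> * of_real x * of_real \<omega>)) * exp (- (\<i> * of_real r * of_real (s * \<omega>)))"
      by (subst exp_add[symmetric]) (rule arg_cong[where f = exp], simp add: algebra_simps)
    moreover have "translate x (dilate s v) (x + s * r) = of_real (s powr (- 1/2)) * v r"
      using assms by (simp add: translate_def dilate_def flip: mult.assoc)
    ultimately show "translate x (dilate s v) (x + s * r) * exp (- (\<i> * of_real (x + s * r) * of_real \<omega>))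
        = (of_real (s powr (- 1/2)) * exp (- (\<i> * of_real x * of_real \<omega>)))
          * (v r * exp (- (\<i> * of_real r * of_real (s * \<omega>))))"
      by (simp only: mult_ac)
  qed
  also have "\<dots> = of_real (s * s powr (- 1/2)) * exp (- (\<i> * of_real x * of_real \<omega>)) * fourier v (s * \<omega>)"
    unfolding fourier_def integral_mult_right_zero scaleR_conv_of_real of_real_mult by (simp only: mult_ac)
  finally show ?thesis
    unfolding \<open>s * s powr (- 1/2) = sqrt s\<close> by (simp only: mult_ac)
qed

lemma has_L2_fourier_translate_dilate:
  assumes "has_L2_fourier g h" and s: "s > 0"
  shows "has_L2_fourier (translate x (dilate s g))
    (\<lambda>\<omega>. exp (- (\<i> * of_real x * of_real \<omega>)) * of_real (sqrt s) * h (s * \<omega>))"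
proof -
  from assms obtain u where
    u: "\<And>k. integrable lborel (u k)" "L2_tendsto u g" "L2_tendsto (\<lambda>k. fourier (u k)) h"
    unfolding has_L2_fourier_def by blast
  have "L2_tendsto (\<lambda>k. translate x (dilate s (u k))) (translate x (dilate s g))"
    unfolding translate_dilate_eq[abs_def]
    using s by (intro L2_tendsto_affine[where A = "s powr (- 1/2)"] u(2)) auto
  moreover have "L2_tendsto (\<lambda>k. fourier (translate x (dilate s (u k))))
      (\<lambda>\<omega>. exp (- (\<i> * of_real x * of_real \<omega>)) * of_real (sqrt s) * h (s * \<omega>))"
    unfolding fourier_translate_dilate[OF s, abs_def]
    using s L2_tendsto_affine[OF u(3), of s "\<lambda>\<omega>. exp (- (\<i> * of_real x * of_real \<omega>)) * of_real (sqrt s)" "sqrt s" 0]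
    by (simp add: norm_mult)
  moreover have "integrable lborel (translate x (dilate s (u k)))" for k
    unfolding translate_dilate_eq[abs_def]
    using s by (intro integrable_mult_right lborel_integrable_real_affine[OF u(1)]) auto
  ultimately show ?thesis
    unfolding has_L2_fourier_def by (intro exI[of _ "\<lambda>k. translate x (dilate s (u k))"]) simp
qed

section \<open>Bergman transforms and their derivatives\<close>

text \<open>
  Away from \<open>0\<close> this is a multiple of the density of an Erlang distribution.
\<close>

lemma integrable_power_exp:
  assumes c: "0 < c"
  shows "integrable lborel (\<lambda>t. indicat_real {0<..} t * (t ^ m * exp (- c * t)))"
proof -
  have "integrable lborel (erlang_density m c)"
    unfolding integrable_iff_bounded
    using nn_integral_erlang_ith_moment[OF c, of m 0] c by simp
  then have "integrable lborel (\<lambda>t. fact m / c ^ Suc m * erlang_density m c t)"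
    by (rule integrable_mult_right)
  then show ?thesis
    by (rule Bochner_Integration.integrable_bound)
       (use c in \<open>auto simp: erlang_density_def indicator_def abs_mult\<close>)
qed

text \<open>
  The indicator is part of the kernel so that it is an element of \<open>L\<^sup>2\<close> of the whole line, where the Fourier
  transform lives. The power \<open>t ^ k * sqrt t\<close> is the weight of the transform of order \<open>k + 1\<close>.
\<close>

definition bergman_kernel :: "nat \<Rightarrow> complex \<Rightarrow> real \<Rightarrow> complex" where
  "bergman_kernel k z t = of_real (indicat_real {0<..} t * (t ^ k * sqrt t)) * exp (\<i> * z * of_real t)"

lemma bergman_kernel_measurable [measurable]: "bergman_kernel k z \<in> borel_measurable borel"
  unfolding bergman_kernel_def[abs_def] by measurable

lemma norm_bergman_kernel:
  "cmod (bergman_kernel k z t) = indicat_real {0<..} t * (t ^ k * sqrt t) * exp (- Im z * t)"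
  by (simp add: bergman_kernel_def norm_mult norm_power indicator_def)

lemma bergman_kernel_square_integrable:
  assumes "Im z > 0"
  shows "square_integrable (bergman_kernel k z)"
proof (rule square_integrable_bound)
  show "integrable lborel (\<lambda>t. indicat_real {0<..} t * (t ^ (2 * k + 1) * exp (- (2 * Im z) * t)))"
    using assms by (intro integrable_power_exp) simp
  show "(cmod (bergman_kernel k z t))\<^sup>2 \<le> indicat_real {0<..} t * (t ^ (2 * k + 1) * exp (- (2 * Im z) * t))" for t
    unfolding norm_bergman_kernel
    by (auto simp: indicator_def power_mult_distrib mult_ac simp flip: power_mult exp_of_nat_mult)
qed measurable

lemma square_integrable_extend_zero:
  assumes "square_integrable_on f {0<..}"
  shows "square_integrable (extend_zero f)"
proof -
  have "extend_zero f = (\<lambda>t. indicat_real {0<..} t *\<^sub>R f t)"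
    by (auto simp: extend_zero_def indicator_def)
  moreover have "(\<lambda>t. (cmod (extend_zero f t))\<^sup>2) = (\<lambda>t. indicat_real {0<..} t *\<^sub>R (cmod (f t))\<^sup>2)"
    by (auto simp: extend_zero_def indicator_def)
  ultimately show ?thesis
    using assms unfolding square_integrable_iff
    by (simp add: square_integrable_on_def set_borel_measurable_def set_integrable_def)
qed

lemma Ber_conv_kernel:
  "Ber (real k + 1) f z = (LINT t|lborel. extend_zero f t * bergman_kernel k z t)"
  unfolding Ber_def set_lebesgue_integral_def
proof (intro Bochner_Integration.integral_cong refl)
  fix t :: real
  have "t powr (real k + 1 - 1/2) = t ^ k * sqrt t" if "t > 0"
    using that powr_add[of t "real k" "1/2"] by (simp add: powr_realpow powr_half_sqrt add.commute)
  then show "indicat_real {0<..} t *\<^sub>R (of_real (t powr (real k + 1 - 1/2)) * f t * exp (\<i> * z * of_real t))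
      = extend_zero f t * bergman_kernel k z t"
    by (simp add: indicator_def extend_zero_def bergman_kernel_def)
qed

text \<open>
  The mean value inequality on the convex half plane above height \<open>a\<close>.
\<close>

lemma norm_exp_diff_le:
  assumes "0 \<le> t" "a \<le> Im w" "a \<le> Im z"
  shows "cmod (exp (\<i> * w * of_real t) - exp (\<i> * z * of_real t)) \<le> t * exp (- a * t) * cmod (w - z)"
proof (rule field_differentiable_bound[where S = "{z. a \<le> Im z}" and f' = "\<lambda>z. \<i> * of_real t * exp (\<i> * z * of_real t)"])
  show "convex {z. a \<le> Im z}"
    by (rule convex_halfspace_Im_ge)
  show "((\<lambda>z. exp (\<i> * z * of_real t)) has_field_derivative \<i> * of_real t * exp (\<i> * z * of_real t)) (at z within {z. a \<le> Im z})" for z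
    by (auto intro!: derivative_eq_intros)
  show "cmod (\<i> * of_real t * exp (\<i> * z * of_real t)) \<le> t * exp (- a * t)" if "z \<in> {z. a \<le> Im z}" for z
    using that assms(1) by (simp add: norm_mult mult_left_mono mult_right_mono)
qed (use assms in auto)

text \<open>
  Dominated convergence for the difference quotients. Near \<open>z\<close> the points \<open>w\<close> stay above half the height of \<open>z\<close>, and
  there the quotients of the kernel of index \<open>k\<close> are bounded by the kernel of index \<open>k + 1\<close> at half that height, which
  is still square integrable.
\<close>

lemma Ber_has_field_derivative:
  assumes f: "square_integrable_on f {0<..}" and z: "Im z > 0"
  shows "(Ber (real k + 1) f has_field_derivative \<i> * Ber (real (Suc k) + 1) f z) (at z)"
proof -
  let ?S = "{w. Im z / 2 < Im w}"
  let ?q = "\<lambda>w t. extend_zero f t * ((bergman_kernel k w t - bergman_kernel k z t) / (w - z))"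
  let ?dom = "\<lambda>t. cmod (extend_zero f t * bergman_kernel (Suc k) (\<i> * of_real (Im z / 2)) t)"
  note [measurable] = square_integrable_measurable[OF square_integrable_extend_zero[OF f]]
  have int: "integrable lborel (\<lambda>t. extend_zero f t * bergman_kernel k w t)" if "Im w > 0" for k w
    by (intro integrable_mult_square_integrable square_integrable_extend_zero f
        bergman_kernel_square_integrable that)
  have quot: "(Ber (real k + 1) f w - Ber (real k + 1) f z) / (w - z) = (LINT t|lborel. ?q w t)"
    if "Im w > 0" for w
    using int[OF that, of k] int[OF z, of k]
    by (simp add: Ber_conv_kernel right_diff_distrib flip: Bochner_Integration.integral_diff)
  have "((\<lambda>w. (Ber (real k + 1) f w - Ber (real k + 1) f z) / (w - z))
      \<longlongrightarrow> \<i> * Ber (real (Suc k) + 1) f z) (at z within ?S)"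
    unfolding tendsto_at_iff_sequentially
  proof (intro allI impI, unfold comp_def)
    fix X assume X: "\<forall>i. X i \<in> ?S - {z}" and lim: "X \<longlonglongrightarrow> z"
    then have Im: "Im (X i) > Im z / 2" "X i \<noteq> z" "Im (X i) > 0" for i
      using z by (auto intro: less_trans[of 0 "Im z / 2"])
    have "(\<lambda>i. LINT t|lborel. ?q (X i) t) \<longlonglongrightarrow> (LINT t|lborel. \<i> * (extend_zero f t * bergman_kernel (Suc k) z t))"
    proof (rule integral_dominated_convergence[where w = ?dom])
      show "integrable lborel ?dom"
        using z by (intro integrable_norm int) simp
      show "AE t in lborel. norm (?q (X i) t) \<le> ?dom t" for i
      proof (intro AE_I2)
        fix t
        show "norm (?q (X i) t) \<le> ?dom t"
        proof (cases "t > 0")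
          case True
          have "cmod (exp (\<i> * X i * of_real t) - exp (\<i> * z * of_real t)) \<le> t * exp (- (Im z / 2) * t) * cmod (X i - z)"
            using True Im[of i] z by (intro norm_exp_diff_le) auto
          then have "cmod ((exp (\<i> * X i * of_real t) - exp (\<i> * z * of_real t)) / (X i - z)) \<le> t * exp (- (Im z / 2) * t)"
            using Im(2)[of i] by (simp add: norm_divide divide_le_eq)
          then have "cmod (extend_zero f t) * ((t ^ k * sqrt t) * cmod ((exp (\<i> * X i * of_real t) - exp (\<i> * z * of_real t)) / (X i - z)))
              \<le> cmod (extend_zero f t) * ((t ^ k * sqrt t) * (t * exp (- (Im z / 2) * t)))"
            using True by (intro mult_left_mono) auto
          moreover have q: "?q (X i) t = extend_zero f t * (of_real (t ^ k * sqrt t) * ((exp (\<i> * X i * of_real t) - exp (\<i> * z * of_real t)) / (X i - z)))"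
            using True by (simp add: bergman_kernel_def right_diff_distrib diff_divide_distrib)
          moreover have "?dom t = cmod (extend_zero f t) * ((t ^ k * sqrt t) * (t * exp (- (Im z / 2) * t)))"
            using True by (simp add: norm_mult norm_bergman_kernel mult_ac)
          moreover have "norm (?q (X i) t) = cmod (extend_zero f t) * ((t ^ k * sqrt t) *
              cmod ((exp (\<i> * X i * of_real t) - exp (\<i> * z * of_real t)) / (X i - z)))"
            unfolding q norm_mult using True by (simp add: norm_mult norm_power norm_divide)
          ultimately show ?thesis
            by (simp only:)
        qed (simp add: extend_zero_def)
      qed
      show "AE t in lborel. (\<lambda>i. ?q (X i) t) \<longlonglongrightarrow> \<i> * (extend_zero f t * bergman_kernel (Suc k) z t)"
      proof (intro AE_I2)
        fix t
        have "((\<lambda>w. bergman_kernel k w t) has_field_derivative \<i> * bergman_kernel (Suc k) z t) (at z)"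
          unfolding bergman_kernel_def by (auto intro!: derivative_eq_intros)
        then have "((\<lambda>w. (bergman_kernel k w t - bergman_kernel k z t) / (w - z)) \<longlongrightarrow> \<i> * bergman_kernel (Suc k) z t) (at z)"
          by (simp add: has_field_derivative_iff)
        then have "((\<lambda>w. (bergman_kernel k w t - bergman_kernel k z t) / (w - z)) \<circ> X) \<longlonglongrightarrow> \<i> * bergman_kernel (Suc k) z t"
          using X lim unfolding tendsto_at_iff_sequentially by auto
        then have "(\<lambda>i. ?q (X i) t) \<longlonglongrightarrow> extend_zero f t * (\<i> * bergman_kernel (Suc k) z t)"
          unfolding comp_def by (intro tendsto_mult tendsto_const)
        then show "(\<lambda>i. ?q (X i) t) \<longlonglongrightarrow> \<i> * (extend_zero f t * bergman_kernel (Suc k) z t)"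
          by (simp add: mult_ac)
      qed
    qed measurable
    then show "(\<lambda>i. (Ber (real k + 1) f (X i) - Ber (real k + 1) f z) / (X i - z)) \<longlonglongrightarrow> \<i> * Ber (real (Suc k) + 1) f z"
      unfolding quot[OF Im(3)] Ber_conv_kernel[of "Suc k"] by simp
  qed
  moreover have "at z within ?S = at z"
    using z by (intro at_within_open open_halfspace_Im_gt) auto
  ultimately show ?thesis
    unfolding has_field_derivative_iff by simp
qed

lemma open_upper_half_plane: "open upper_half_plane"
  unfolding upper_half_plane_def by (rule open_halfspace_Im_gt)

lemma holomorphic_Ber:
  assumes "square_integrable_on f {0<..}"
  shows "Ber (real k + 1) f holomorphic_on upper_half_plane"
proof (rule holomorphic_onI)
  fix z assume "z \<in> upper_half_plane"
  then have "(Ber (real k + 1) f has_field_derivative \<i> * Ber (real (Suc k) + 1) f z) (at z)"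
    by (intro Ber_has_field_derivative assms) (simp add: upper_half_plane_def)
  then have "Ber (real k + 1) f field_differentiable at z"
    unfolding field_differentiable_def by blast
  then show "Ber (real k + 1) f field_differentiable at z within upper_half_plane"
    by (rule field_differentiable_at_within)
qed

lemma higher_deriv_Ber:
  assumes f: "square_integrable_on f {0<..}" and z: "z \<in> upper_half_plane"
  shows "(deriv ^^ k) (Ber 1 f) z = \<i> ^ k * Ber (real k + 1) f z"
  using z
proof (induction k arbitrary: z)
  case (Suc k)
  have "((\<lambda>w. \<i> ^ k * Ber (real k + 1) f w) has_field_derivative \<i> ^ k * (\<i> * Ber (real (Suc k) + 1) f z)) (at z)"
    using Suc.prems f by (intro DERIV_cmult Ber_has_field_derivative) (auto simp: upper_half_plane_def)
  then have "((deriv ^^ k) (Ber 1 f) has_field_derivative \<i> ^ k * (\<i> * Ber (real (Suc k) + 1) f z)) (at z)"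
    by (rule has_field_derivative_transform_within_open[OF _ open_upper_half_plane Suc.prems])
       (simp add: Suc.IH)
  then show ?case
    by (simp add: DERIV_imp_deriv)
qed simp

section \<open>Wirtinger derivatives of polynomials in the imaginary part\<close>

text \<open>
  Divided powers are used because differentiation in the imaginary part then only shifts the index,
  which keeps falling factorials out of Leibniz' formula.
\<close>

definition im_pow :: "nat \<Rightarrow> complex \<Rightarrow> complex" where
  "im_pow j w = of_real (Im w ^ j / fact j)"

text \<open>
  The derivative of \<open>im_pow j\<close> in the imaginary part. The case \<open>j = 0\<close> must be separate, because \<open>j - 1\<close> is
  truncated.
\<close>

definition im_pow' :: "nat \<Rightarrow> complex \<Rightarrow> complex" where
  "im_pow' j w = (if j = 0 then 0 else im_pow (j - 1) w)"

lemma im_pow_has_vector_derivative: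
  "((\<lambda>s. im_pow j (Complex x s)) has_vector_derivative im_pow' j (Complex x s)) (at s)"
proof -
  have "((\<lambda>s. s ^ j / fact j) has_real_derivative (if j = 0 then 0 else s ^ (j - 1) / fact (j - 1))) (at s)"
  proof (cases j)
    case (Suc m)
    have "((\<lambda>s. s ^ Suc m / fact (Suc m)) has_real_derivative real (Suc m) * s ^ m / fact (Suc m)) (at s)"
      using DERIV_cdivide[OF DERIV_pow[of "Suc m" s], of "fact (Suc m)"] by simp
    also have "real (Suc m) * s ^ m / fact (Suc m) = s ^ m / fact m"
      by (simp add: fact_Suc del: of_nat_Suc)
    finally show ?thesis
      using Suc by simp
  qed simp
  then have "((\<lambda>s. complex_of_real (s ^ j / fact j)) has_vector_derivative
      of_real (if j = 0 then 0 else s ^ (j - 1) / fact (j - 1))) (at s)"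
    by (intro has_vector_derivative_of_real) (simp add: has_real_derivative_iff_has_vector_derivative)
  then show ?thesis
    by (simp add: im_pow_def im_pow'_def if_distrib cong: if_cong)
qed

lemma has_vector_derivative_along_real:
  assumes "(H has_field_derivative H') (at z)"
  shows "((\<lambda>x. H (Complex x (Im z))) has_vector_derivative H') (at (Re z))"
proof -
  have "((\<lambda>x. Complex x (Im z)) has_vector_derivative 1) (at (Re z))"
    unfolding Complex_eq by (auto intro!: derivative_eq_intros)
  from field_vector_diff_chain_at[OF this, of H H'] assms show ?thesis
    by (simp add: comp_def)
qed

lemma has_vector_derivative_along_imag:
  assumes "(H has_field_derivative H') (at z)"
  shows "((\<lambda>s. H (Complex (Re z) s)) has_vector_derivative \<i> * H') (at (Im z))"
proof -
  have "((\<lambda>s. Complex (Re z) s) has_vector_derivative \<i>) (at (Im z))"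
    unfolding Complex_eq by (auto intro!: derivative_eq_intros)
  from field_vector_diff_chain_at[OF this, of H H'] assms show ?thesis
    by (simp add: comp_def)
qed

text \<open>
  Along the real direction \<open>im_pow\<close> is constant and \<open>H\<close> contributes \<open>H'\<close>; along the imaginary
  direction the product rule applies and \<open>H\<close> contributes \<open>\<i> * H'\<close>. In \<open>d_dz\<close> the two contributions of \<open>H'\<close> add up, in
  \<open>d_dzbar\<close> they cancel. The representation of \<open>G\<close> is only assumed on an open set, so that the lemma can be
  iterated.
\<close>

lemma wirtinger_sum:
  assumes U: "open U" "z \<in> U"
    and G: "\<And>w. w \<in> U \<Longrightarrow> G w = (\<Sum>a\<in>A. im_pow (p a) w * H a w)"
    and H: "\<And>a. a \<in> A \<Longrightarrow> (H a has_field_derivative H' a) (at z)"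
  shows d_dz_sum: "d_dz G z = (\<Sum>a\<in>A. im_pow (p a) z * H' a + im_pow' (p a) z / (2 * \<i>) * H a z)"
    and d_dzbar_sum: "d_dzbar G z = (\<Sum>a\<in>A. \<i> / 2 * im_pow' (p a) z * H a z)"
proof -
  have cont: "continuous_on UNIV (\<lambda>x. Complex x (Im z))" "continuous_on UNIV (\<lambda>s. Complex (Re z) s)"
    unfolding Complex_eq by (intro continuous_intros)+
  have open_sections: "open ((\<lambda>x. Complex x (Im z)) -` U)" "open ((\<lambda>s. Complex (Re z) s) -` U)"
    using cont U(1) by (auto intro: open_vimage)
  have im: "im_pow (p a) (Complex x (Im z)) = im_pow (p a) z" for a x
    by (simp add: im_pow_def)
  have "((\<lambda>x. \<Sum>a\<in>A. im_pow (p a) (Complex x (Im z)) * H a (Complex x (Im z)))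
      has_vector_derivative (\<Sum>a\<in>A. im_pow (p a) z * H' a)) (at (Re z))"
    unfolding im
    by (intro has_vector_derivative_sum has_vector_derivative_mult_right has_vector_derivative_along_real H)
  then have "((\<lambda>x. G (Complex x (Im z))) has_vector_derivative (\<Sum>a\<in>A. im_pow (p a) z * H' a)) (at (Re z))"
    by (rule has_vector_derivative_transform_within_open[OF _ open_sections(1)]) (use U G in auto)
  then have dx: "vector_derivative (\<lambda>x. G (Complex x (Im z))) (at (Re z)) = (\<Sum>a\<in>A. im_pow (p a) z * H' a)"
    by (rule vector_derivative_at)
  have "((\<lambda>s. \<Sum>a\<in>A. im_pow (p a) (Complex (Re z) s) * H a (Complex (Re z) s)) has_vector_derivative
      (\<Sum>a\<in>A. im_pow (p a) z * (\<i> * H' a) + im_pow' (p a) z * H a z)) (at (Im z))"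
  proof (intro has_vector_derivative_sum)
    fix a assume "a \<in> A"
    show "((\<lambda>s. im_pow (p a) (Complex (Re z) s) * H a (Complex (Re z) s)) has_vector_derivative
        im_pow (p a) z * (\<i> * H' a) + im_pow' (p a) z * H a z) (at (Im z))"
      using has_vector_derivative_mult[OF im_pow_has_vector_derivative[of "p a" "Re z" "Im z"]
          has_vector_derivative_along_imag[OF H[OF \<open>a \<in> A\<close>]]]
      by simp
  qed
  then have "((\<lambda>s. G (Complex (Re z) s)) has_vector_derivative
      (\<Sum>a\<in>A. im_pow (p a) z * (\<i> * H' a) + im_pow' (p a) z * H a z)) (at (Im z))"
    by (rule has_vector_derivative_transform_within_open[OF _ open_sections(2)]) (use U G in auto)
  then have ds: "vector_derivative (\<lambda>s. G (Complex (Re z) s)) (at (Im z))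
      = (\<Sum>a\<in>A. im_pow (p a) z * (\<i> * H' a) + im_pow' (p a) z * H a z)"
    by (rule vector_derivative_at)
  define X where "X = (\<Sum>a\<in>A. im_pow (p a) z * H' a)"
  define Y where "Y = (\<Sum>a\<in>A. im_pow' (p a) z * H a z)"
  have ds': "(\<Sum>a\<in>A. im_pow (p a) z * (\<i> * H' a) + im_pow' (p a) z * H a z) = \<i> * X + Y"
    by (simp add: X_def Y_def sum.distrib sum_distrib_left mult.left_commute)
  have inv: "c / (2 * \<i>) = - (\<i> / 2) * c" for c
    by (simp add: field_simps)
  have "(\<Sum>a\<in>A. im_pow (p a) z * H' a + im_pow' (p a) z / (2 * \<i>) * H a z) = X - \<i> / 2 * Y"
    unfolding inv by (simp add: X_def Y_def sum.distrib sum_distrib_left sum_subtractf mult.assoc)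
  then show "d_dz G z = (\<Sum>a\<in>A. im_pow (p a) z * H' a + im_pow' (p a) z / (2 * \<i>) * H a z)"
    unfolding d_dz_def dx ds ds' X_def[symmetric] by (simp add: algebra_simps)
  have "(\<Sum>a\<in>A. \<i> / 2 * im_pow' (p a) z * H a z) = \<i> / 2 * Y"
    by (simp add: Y_def sum_distrib_left mult.assoc)
  then show "d_dzbar G z = (\<Sum>a\<in>A. \<i> / 2 * im_pow' (p a) z * H a z)"
    unfolding d_dzbar_def dx ds ds' X_def[symmetric] by (simp add: algebra_simps)
qed

text \<open>
  Pascal's identity under a sum, in the form needed for an iterated two-term recurrence.
\<close>

lemma sum_choose_Suc:
  fixes T :: "nat \<Rightarrow> 'a::comm_semiring_1"
  shows "(\<Sum>k\<le>Suc m. of_nat (Suc m choose k) * T k)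
    = (\<Sum>k\<le>m. of_nat (m choose k) * T (Suc k)) + (\<Sum>k\<le>m. of_nat (m choose k) * T k)"
proof -
  have "(\<Sum>k\<le>Suc m. of_nat (Suc m choose k) * T k)
      = T 0 + (\<Sum>k\<le>m. of_nat (m choose k) * T (Suc k)) + (\<Sum>k\<le>m. of_nat (m choose Suc k) * T (Suc k))"
    by (subst sum.atMost_Suc_shift) (simp add: distrib_right sum.distrib add.assoc)
  also have "T 0 + (\<Sum>k\<le>m. of_nat (m choose k) * T (Suc k)) + (\<Sum>k\<le>m. of_nat (m choose Suc k) * T (Suc k))
      = (\<Sum>k\<le>m. of_nat (m choose k) * T (Suc k)) + (\<Sum>k\<le>Suc m. of_nat (m choose k) * T k)"
    unfolding sum.atMost_Suc_shift[of "\<lambda>k. of_nat (m choose k) * T k"] by (simp add: add_ac)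
  finally show ?thesis by (simp add: binomial_eq_0)
qed

text \<open>
  Each application of \<open>d_dz\<close> either differentiates the holomorphic factor or lowers the power of the
  imaginary part at the cost of a factor \<open>1 / (2 * \<i>)\<close>. The restriction \<open>m \<le> n\<close> guarantees that the
  power never runs out, so the index \<open>n - (m - k)\<close> is a true difference.
\<close>

lemma d_dz_power_Leibniz:
  assumes U: "open U"
    and F: "\<And>k w. w \<in> U \<Longrightarrow> (F k has_field_derivative F (Suc k) w) (at w)"
    and "m \<le> n" "z \<in> U"
  shows "(d_dz ^^ m) (\<lambda>w. of_real (Im w) ^ n * F 0 w) z
    = (\<Sum>k\<le>m. of_nat (m choose k) * (fact n * im_pow (n - (m - k)) z * (1 / (2 * \<i>)) ^ (m - k) * F k z))"
  using assms(3,4)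
proof (induction m arbitrary: z)
  case 0
  then show ?case by (simp add: im_pow_def)
next
  case (Suc m)
  let ?c = "1 / (2 * \<i>)"
  let ?T = "\<lambda>k. fact n * im_pow (n - (Suc m - k)) z * ?c ^ (Suc m - k) * F k z"
  have "(d_dz ^^ Suc m) (\<lambda>w. of_real (Im w) ^ n * F 0 w) z
      = (\<Sum>k\<le>m. im_pow (n - (m - k)) z * (of_nat (m choose k) * fact n * ?c ^ (m - k) * F (Suc k) z)
         + im_pow' (n - (m - k)) z / (2 * \<i>) * (of_nat (m choose k) * fact n * ?c ^ (m - k) * F k z))"
    unfolding funpow.simps comp_def
  proof (rule d_dz_sum[OF U \<open>z \<in> U\<close>])
    show "(d_dz ^^ m) (\<lambda>w. of_real (Im w) ^ n * F 0 w) w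
        = (\<Sum>k\<le>m. im_pow (n - (m - k)) w * (of_nat (m choose k) * fact n * ?c ^ (m - k) * F k w))"
      if "w \<in> U" for w
      using Suc that by (simp add: mult_ac)
    show "((\<lambda>w. of_nat (m choose k) * fact n * ?c ^ (m - k) * F k w) has_field_derivative
        of_nat (m choose k) * fact n * ?c ^ (m - k) * F (Suc k) z) (at z)" for k
      by (intro DERIV_cmult F Suc.prems)
  qed
  also have "\<dots> = (\<Sum>k\<le>m. of_nat (m choose k) * ?T (Suc k)) + (\<Sum>k\<le>m. of_nat (m choose k) * ?T k)"
    unfolding sum.distrib[symmetric]
  proof (intro sum.cong refl)
    fix k assume "k \<in> {..m}"
    then have "Suc m - k = Suc (m - k)" "n - (m - k) = Suc (n - (Suc m - k))"
      using Suc.prems by auto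
    then show "im_pow (n - (m - k)) z * (of_nat (m choose k) * fact n * ?c ^ (m - k) * F (Suc k) z)
         + im_pow' (n - (m - k)) z / (2 * \<i>) * (of_nat (m choose k) * fact n * ?c ^ (m - k) * F k z)
        = of_nat (m choose k) * ?T (Suc k) + of_nat (m choose k) * ?T k"
      by (simp add: im_pow'_def mult_ac)
  qed
  also have "\<dots> = (\<Sum>k\<le>Suc m. of_nat (Suc m choose k) * ?T k)"
    by (rule sum_choose_Suc[symmetric])
  finally show ?case .
qed

lemma im_pow_differentiable: "im_pow j differentiable (at z within U)"
proof -
  have "(\<lambda>w. of_real (1 / fact j) * complex_of_real (Im w) ^ j) differentiable (at z within U)"
    by (intro differentiable_mult differentiable_power differentiable_const
        bounded_linear_imp_differentiable bounded_linear_compose[OF bounded_linear_of_real bounded_linear_Im])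
  then show ?thesis
    by (simp add: im_pow_def[abs_def])
qed

text \<open>
  Applying \<open>d_dzbar\<close> leaves a sum of the same kind with one term less, hence an induction on the number of
  terms with arbitrary coefficients.
\<close>

lemma polyanalytic_on_sum:
  assumes U: "open U"
    and G: "\<And>w. w \<in> U \<Longrightarrow> G w = (\<Sum>k<N. im_pow k w * H k w)"
    and H: "\<And>k. k < N \<Longrightarrow> H k holomorphic_on U"
  shows "polyanalytic_on N G U"
  using G H
proof (induction N arbitrary: G H)
  case 0
  then show ?case by (simp add: polyanalytic_on_def)
next
  case (Suc N)
  have D: "(H k has_field_derivative deriv (H k) w) (at w)" if "k < Suc N" "w \<in> U" for k w
    using holomorphic_derivI[OF Suc.prems(2) U] that by blast
  have "G differentiable_on U"
    unfolding differentiable_on_def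
  proof
    fix z assume "z \<in> U"
    have "(\<lambda>w. \<Sum>k<Suc N. im_pow k w * H k w) differentiable (at z within U)"
    proof (intro differentiable_sum differentiable_mult im_pow_differentiable finite_lessThan ballI)
      fix k assume "k \<in> {..<Suc N}"
      then have "(H k has_derivative (*) (deriv (H k) z)) (at z)"
        using D[OF _ \<open>z \<in> U\<close>, of k] by (simp add: has_field_derivative_def)
      then show "H k differentiable (at z within U)"
        by (rule differentiable_at_withinI[OF differentiableI])
    qed
    then show "G differentiable (at z within U)"
      by (rule differentiable_transform_within[OF _ zero_less_one \<open>z \<in> U\<close>]) (simp add: Suc.prems)
  qed
  moreover have "polyanalytic_on N (d_dzbar G) U"
  proof (rule Suc.IH)
    fix w assume "w \<in> U"
    then have "d_dzbar G w = (\<Sum>k<Suc N. \<i> / 2 * im_pow' k w * H k w)"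
      by (intro d_dzbar_sum[OF U _ Suc.prems(1) D]) auto
    also have "\<dots> = (\<Sum>k<N. im_pow k w * (\<i> / 2 * H (Suc k) w))"
      by (subst sum.lessThan_Suc_shift) (simp add: im_pow'_def mult_ac)
    finally show "d_dzbar G w = (\<Sum>k<N. im_pow k w * (\<i> / 2 * H (Suc k) w))" .
  next
    show "(\<lambda>w. \<i> / 2 * H (Suc k) w) holomorphic_on U" if "k < N" for k
      using that by (intro holomorphic_intros Suc.prems) simp
  qed
  moreover have "(d_dzbar ^^ Suc k) G = (d_dzbar ^^ k) (d_dzbar G)" for k
    by (simp only: funpow_Suc_right comp_apply)
  ultimately show ?case
    unfolding polyanalytic_on_def All_less_Suc2 by (simp only: funpow_0 simp_thms)
qed


section \<open>Expansions of the true polyanalytic transform\<close>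

lemma leibniz_constant:
  fixes b c :: complex
  assumes "c \<noteq> 0" "b \<noteq> 0" "k \<le> n"
  shows "1 / (c ^ n * b) * b * (1 / c) ^ (n - k) = 1 / c ^ (2 * n) * c ^ k"
proof -
  obtain m where "n = m + k"
    using assms(3) by (metis le_add_diff_inverse2)
  then show ?thesis
    using assms(1,2) by (simp add: power_one_over power_add mult_2 divide_simps)
qed

text \<open>
  Leibniz' formula with as many derivatives as there are powers of the imaginary part. It is stated with the
  derivatives of \<open>Ber 1 f\<close> already written as Bergman transforms, from which both explicit forms
  are read off.
\<close>

lemma poly_Ber_expansion:
  assumes f: "square_integrable_on f {0<..}" and z: "z \<in> upper_half_plane"
  shows "poly_Ber n f z = 1 / (2 * \<i>) ^ (2 * n) *
    (\<Sum>k\<le>n. (2 * \<i>) ^ k * of_nat (n choose k) * im_pow k z * (\<i> ^ k * Ber (real k + 1) f z))"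
proof -
  let ?F = "\<lambda>k w. \<i> ^ k * Ber (real k + 1) f w"
  have "(d_dz ^^ n) (\<lambda>w. of_real (Im w) ^ n * ?F 0 w) z
    = (\<Sum>k\<le>n. of_nat (n choose k) * (fact n * im_pow (n - (n - k)) z * (1 / (2 * \<i>)) ^ (n - k) * ?F k z))"
  proof (rule d_dz_power_Leibniz[OF open_upper_half_plane])
    show "(?F k has_field_derivative ?F (Suc k) w) (at w)" if "w \<in> upper_half_plane" for k w
      using DERIV_cmult[OF Ber_has_field_derivative[OF f, of w k], of "\<i> ^ k"] that
      by (simp add: upper_half_plane_def mult_ac)
  qed (use z in auto)
  then have "poly_Ber n f z = 1 / ((2 * \<i>) ^ n * fact n) *
      (\<Sum>k\<le>n. of_nat (n choose k) * (fact n * im_pow (n - (n - k)) z * (1 / (2 * \<i>)) ^ (n - k) * ?F k z))"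
    by (simp add: poly_Ber_def)
  also have "\<dots> = 1 / (2 * \<i>) ^ (2 * n) *
    (\<Sum>k\<le>n. (2 * \<i>) ^ k * of_nat (n choose k) * im_pow k z * ?F k z)"
    unfolding sum_distrib_left
  proof (intro sum.cong refl)
    fix k assume "k \<in> {..n}"
    then have k: "n - (n - k) = k"
      by simp
    have c: "1 / ((2 * \<i>) ^ n * fact n) * fact n * (1 / (2 * \<i>)) ^ (n - k)
        = 1 / (2 * \<i>) ^ (2 * n) * (2 * \<i>) ^ k"
      using \<open>k \<in> {..n}\<close> by (intro leibniz_constant) auto
    have "1 / ((2 * \<i>) ^ n * fact n) * (of_nat (n choose k) * (fact n * im_pow k z * (1 / (2 * \<i>)) ^ (n - k) * ?F k z))
        = (1 / ((2 * \<i>) ^ n * fact n) * fact n * (1 / (2 * \<i>)) ^ (n - k)) * (of_nat (n choose k) * im_pow k z * ?F k z)"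
      by (simp only: mult_ac)
    also have "\<dots> = 1 / (2 * \<i>) ^ (2 * n) * ((2 * \<i>) ^ k * of_nat (n choose k) * im_pow k z * ?F k z)"
      unfolding c by (simp only: mult_ac)
    finally show "1 / ((2 * \<i>) ^ n * fact n) * (of_nat (n choose k) * (fact n * im_pow (n - (n - k)) z * (1 / (2 * \<i>)) ^ (n - k) * ?F k z))
        = 1 / (2 * \<i>) ^ (2 * n) * ((2 * \<i>) ^ k * of_nat (n choose k) * im_pow k z * ?F k z)"
      unfolding k .
  qed
  finally show ?thesis .
qed

lemma polyanalytic_poly_Ber:
  assumes f: "square_integrable_on f {0<..}"
  shows "polyanalytic_on (n + 1) (poly_Ber n f) upper_half_plane"
proof (rule polyanalytic_on_sum[OF open_upper_half_plane])
  let ?H = "\<lambda>k w. (1 / (2 * \<i>) ^ (2 * n) * (2 * \<i>) ^ k * of_nat (n choose k) * \<i> ^ k) * Ber (real k + 1) f w"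
  show "poly_Ber n f w = (\<Sum>k<n + 1. im_pow k w * ?H k w)" if "w \<in> upper_half_plane" for w
    unfolding poly_Ber_expansion[OF f that] sum_distrib_left Suc_eq_plus1[symmetric] lessThan_Suc_atMost
    by (simp only: mult_ac)
  show "?H k holomorphic_on upper_half_plane" for k
    by (intro holomorphic_on_mult holomorphic_on_const holomorphic_Ber f)
qed

section \<open>Laguerre functions and the wavelet formula\<close>

text \<open>
  The coefficients of the polynomial \<open>laguerre n (2 * t)\<close> in \<open>t\<close>.
\<close>

definition laguerre_coeff :: "nat \<Rightarrow> nat \<Rightarrow> complex" where
  "laguerre_coeff n k = (- 2) ^ k * of_nat (n choose k) * (1 / fact k)"

text \<open>
  The Fourier transform of \<open>Phi n\<close> is a combination of Bergman kernels at the point \<open>\<i>\<close>: the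
  argument \<open>2 * t\<close> turns the factor \<open>exp (- t / 2)\<close> of the Laguerre function into \<open>exp (\<i> * \<i> * t)\<close>.
\<close>

lemma laguerre_fun_conv_kernel:
  "of_real (sqrt t * laguerre_fun n (2 * t)) = (\<Sum>k\<le>n. laguerre_coeff n k * bergman_kernel k \<i> t)"
proof (cases "t > 0")
  case True
  have "of_real (sqrt t * laguerre_fun n (2 * t))
      = of_real (sqrt t * exp (- t)) * (\<Sum>k\<le>n. complex_of_real ((-1) ^ k * real (n choose k) * ((2 * t) ^ k / fact k)))"
    using True by (simp add: laguerre_fun_def laguerre_def mult_ac)
  also have "\<dots> = (\<Sum>k\<le>n. laguerre_coeff n k * bergman_kernel k \<i> t)"
    unfolding sum_distrib_left
  proof (intro sum.cong refl)
    fix k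
    have "complex_of_real ((-1) ^ k * real (n choose k) * ((2 * t) ^ k / fact k)) = laguerre_coeff n k * of_real (t ^ k)"
    proof -
      have sign: "(-1) ^ k * (2 * t) ^ k = (- 2) ^ k * t ^ k"
        by (simp only: power_mult_distrib[symmetric]) simp
      have "(-1) ^ k * real (n choose k) * ((2 * t) ^ k / fact k)
          = ((-1) ^ k * (2 * t) ^ k) * (real (n choose k) * (1 / fact k))"
        by (simp only: divide_inverse mult_1_left mult_ac)
      also have "\<dots> = (- 2) ^ k * real (n choose k) * (1 / fact k) * t ^ k"
        unfolding sign by (simp only: mult_ac)
      finally show ?thesis
        by (simp only: laguerre_coeff_def) simp
    qed
    moreover have "bergman_kernel k \<i> t = of_real (t ^ k) * of_real (sqrt t * exp (- t))"
    proof -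
      have "exp (\<i> * \<i> * of_real t) = exp (complex_of_real (- t))"
        by (rule arg_cong[where f = exp]) simp
      also have "\<dots> = of_real (exp (- t))"
        by (rule exp_of_real)
      finally show ?thesis
        using True unfolding bergman_kernel_def by simp
    qed
    ultimately show "of_real (sqrt t * exp (- t)) * complex_of_real ((-1) ^ k * real (n choose k) * ((2 * t) ^ k / fact k))
        = laguerre_coeff n k * bergman_kernel k \<i> t"
      by (simp only: mult_ac)
  qed
  finally show ?thesis .
next
  case False
  then show ?thesis
    by (cases "t = 0") (simp_all add: laguerre_fun_def bergman_kernel_def)
qed

lemma laguerre_square_integrable:
  "square_integrable (\<lambda>t. of_real (sqrt t * laguerre_fun n (2 * t)))"
  unfolding laguerre_fun_conv_kernel
  by (intro square_integrable_sum square_integrable_cmult bergman_kernel_square_integrable) simp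

text \<open>
  Dilation and modulation, the Fourier images of the wavelet dilation and translation, move the kernel from the base
  point \<open>\<i>\<close> to an arbitrary point \<open>x + \<i> * s\<close> of the half plane.
\<close>

lemma bergman_kernel_dilate:
  assumes "s > 0"
  shows "exp (\<i> * of_real x * of_real t) * of_real (sqrt s) * bergman_kernel k \<i> (s * t)
    = of_real (s ^ Suc k) * bergman_kernel k (Complex x s) t"
proof -
  have "exp (\<i> * of_real x * of_real t) * exp (\<i> * \<i> * of_real (s * t)) = exp (\<i> * Complex x s * of_real t)"
    unfolding exp_add[symmetric] Complex_eq by (rule arg_cong[where f = exp]) (simp add: algebra_simps)
  moreover have "indicat_real {0<..} (s * t) = indicat_real {0<..} t"
    using assms by (simp add: indicator_def zero_less_mult_iff)
  moreover have "complex_of_real (sqrt s) * of_real ((s * t) ^ k * sqrt (s * t)) = of_real (s ^ Suc k) * of_real (t ^ k * sqrt t)"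
  proof -
    have "sqrt s * ((s * t) ^ k * sqrt (s * t)) = s ^ Suc k * (t ^ k * sqrt t)"
      using assms by (simp add: real_sqrt_mult power_mult_distrib)
    then show ?thesis
      by (simp only: of_real_mult[symmetric])
  qed
  moreover have "exp (\<i> * of_real x * of_real t) * of_real (sqrt s) * bergman_kernel k \<i> (s * t)
      = of_real (indicat_real {0<..} (s * t)) * (complex_of_real (sqrt s) * of_real ((s * t) ^ k * sqrt (s * t)))
        * (exp (\<i> * of_real x * of_real t) * exp (\<i> * \<i> * of_real (s * t)))"
    unfolding bergman_kernel_def of_real_mult[of "indicat_real _ _"] by (simp only: mult_ac)
  moreover have "of_real (s ^ Suc k) * bergman_kernel k (Complex x s) t
      = of_real (indicat_real {0<..} t) * (of_real (s ^ Suc k) * of_real (t ^ k * sqrt t)) * exp (\<i> * Complex x s * of_real t)"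
    unfolding bergman_kernel_def of_real_mult[of "indicat_real _ _"] by (simp only: mult_ac)
  ultimately show ?thesis
    by (simp only:)
qed

text \<open>
  The function on the right of the inner product is the Fourier transform of the translated and dilated
  \<open>Phi n\<close>; conjugation turns its character into the one in the Bergman kernel at \<open>x + \<i> * s\<close>.
\<close>

lemma L2_inner_laguerre:
  assumes f: "square_integrable_on f {0<..}" and s: "s > 0"
  shows "L2_inner (extend_zero f)
      (\<lambda>t. exp (- (\<i> * of_real x * of_real t)) * of_real (sqrt s) * of_real (sqrt (s * t) * laguerre_fun n (2 * (s * t))))
    = of_real s * (\<Sum>k\<le>n. laguerre_coeff n k * of_real s ^ k * Ber (real k + 1) f (Complex x s))"
proof -
  have "extend_zero f t * cnj (exp (- (\<i> * of_real x * of_real t)) * of_real (sqrt s) * of_real (sqrt (s * t) * laguerre_fun n (2 * (s * t))))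
      = (\<Sum>k\<le>n. (of_real s * (laguerre_coeff n k * of_real s ^ k)) * (extend_zero f t * bergman_kernel k (Complex x s) t))" for t
  proof -
    have "extend_zero f t * cnj (exp (- (\<i> * of_real x * of_real t)) * of_real (sqrt s) * of_real (sqrt (s * t) * laguerre_fun n (2 * (s * t))))
        = extend_zero f t * (exp (\<i> * of_real x * of_real t) * of_real (sqrt s) * of_real (sqrt (s * t) * laguerre_fun n (2 * (s * t))))"
      by (simp add: exp_cnj)
    also have "\<dots> = (\<Sum>k\<le>n. extend_zero f t * (laguerre_coeff n k * (exp (\<i> * of_real x * of_real t) * of_real (sqrt s) * bergman_kernel k \<i> (s * t))))"
      unfolding laguerre_fun_conv_kernel sum_distrib_left by (simp only: mult_ac)
    also have "\<dots> = (\<Sum>k\<le>n. (of_real s * (laguerre_coeff n k * of_real s ^ k)) * (extend_zero f t * bergman_kernel k (Complex x s) t))"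
      unfolding bergman_kernel_dilate[OF s] by (simp add: mult_ac)
    finally show ?thesis .
  qed
  then have "L2_inner (extend_zero f)
      (\<lambda>t. exp (- (\<i> * of_real x * of_real t)) * of_real (sqrt s) * of_real (sqrt (s * t) * laguerre_fun n (2 * (s * t))))
      = (LINT t|lborel. (\<Sum>k\<le>n. (of_real s * (laguerre_coeff n k * of_real s ^ k)) * (extend_zero f t * bergman_kernel k (Complex x s) t)))"
    unfolding L2_inner_def by (simp only:)
  also have "\<dots> = (\<Sum>k\<le>n. (of_real s * (laguerre_coeff n k * of_real s ^ k)) * Ber (real k + 1) f (Complex x s))"
  proof (subst Bochner_Integration.integral_sum)
    show "integrable lborel (\<lambda>t. (of_real s * (laguerre_coeff n k * of_real s ^ k)) * (extend_zero f t * bergman_kernel k (Complex x s) t))" for k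
      using s by (intro integrable_mult_right integrable_mult_square_integrable square_integrable_extend_zero f
          bergman_kernel_square_integrable) simp
  qed (simp only: integral_mult_right_zero Ber_conv_kernel)
  also have "\<dots> = of_real s * (\<Sum>k\<le>n. laguerre_coeff n k * of_real s ^ k * Ber (real k + 1) f (Complex x s))"
    by (simp add: sum_distrib_left mult.assoc)
  finally show ?thesis .
qed

lemma wavelet_Phi:
  assumes f: "square_integrable_on f {0<..}" and s: "s > 0"
  shows "2 * of_real pi * wavelet (Phi n) (inv_fourier (extend_zero f)) x s
    = of_real s * (\<Sum>k\<le>n. laguerre_coeff n k * of_real s ^ k * Ber (real k + 1) f (Complex x s))"
proof -
  have "has_L2_fourier (inv_fourier (extend_zero f)) (extend_zero f)"
    by (intro has_L2_fourier_inv_fourier square_integrable_extend_zero f)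
  moreover have "has_L2_fourier (translate x (dilate s (Phi n)))
      (\<lambda>t. exp (- (\<i> * of_real x * of_real t)) * of_real (sqrt s) * of_real (sqrt (s * t) * laguerre_fun n (2 * (s * t))))"
    unfolding Phi_def
    by (rule has_L2_fourier_translate_dilate[OF has_L2_fourier_inv_fourier[OF laguerre_square_integrable] s])
  ultimately show ?thesis
    unfolding wavelet_def L2_inner_laguerre[OF f s, symmetric] by (rule L2_fourier_parseval[symmetric])
qed

theorem proposition3:
  fixes n :: nat and f :: "real \<Rightarrow> complex" and F :: "complex \<Rightarrow> complex"
    and z :: complex and x s :: real
  assumes "square_integrable_on f {0<..}"
    and "F = Ber 1 f"
    and "z = Complex x s" and "z \<in> upper_half_plane"
  shows "polyanalytic_on (n + 1) (poly_Ber n f) upper_half_plane \<and>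
         poly_Ber n f z = 1 / (2 * \<i>) ^ (2 * n) *
           (\<Sum>k\<le>n. (2 * \<i>) ^ k * of_nat (n choose k) * (1 / fact k) * of_real s ^ k * (deriv ^^ k) F z) \<and>
         poly_Ber n f z = 1 / (2 * \<i>) ^ (2 * n) *
           (\<Sum>k\<le>n. (- 2) ^ k * of_nat (n choose k) * (1 / fact k) * of_real s ^ k * Ber (real k + 1) f z) \<and>
         poly_Ber n f z = 1 / (2 * \<i>) ^ (2 * n) * of_real (2 * pi) *
           (of_real (inverse s) * wavelet (Phi n) (inv_fourier (extend_zero f)) x s)"
proof -
  note f = assms(1) and z = assms(4)
  have s: "s > 0"
    using assms(3,4) by (simp add: upper_half_plane_def)
  have im: "im_pow k z = 1 / fact k * of_real s ^ k" for k
    by (simp add: im_pow_def assms(3))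
  have i2: "(2 * \<i>) ^ k * \<i> ^ k = (- 2) ^ k" for k
    unfolding power_mult_distrib[symmetric] by (simp add: mult.assoc)
  let ?c = "1 / (2 * \<i>) ^ (2 * n) :: complex"
  have deriv_form: "poly_Ber n f z = ?c *
      (\<Sum>k\<le>n. (2 * \<i>) ^ k * of_nat (n choose k) * (1 / fact k) * of_real s ^ k * (deriv ^^ k) F z)"
    unfolding poly_Ber_expansion[OF f z] im assms(2) higher_deriv_Ber[OF f z] by (simp only: mult_ac)
  have Ber_form: "poly_Ber n f z = ?c *
      (\<Sum>k\<le>n. (- 2) ^ k * of_nat (n choose k) * (1 / fact k) * of_real s ^ k * Ber (real k + 1) f z)"
    unfolding poly_Ber_expansion[OF f z] im i2[symmetric] by (simp only: mult_ac)
  have "of_real (2 * pi) * (of_real (inverse s) * wavelet (Phi n) (inv_fourier (extend_zero f)) x s)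
      = of_real (inverse s) * (2 * of_real pi * wavelet (Phi n) (inv_fourier (extend_zero f)) x s)"
    by simp
  also have "\<dots> = (\<Sum>k\<le>n. (- 2) ^ k * of_nat (n choose k) * (1 / fact k) * of_real s ^ k * Ber (real k + 1) f z)"
    unfolding wavelet_Phi[OF f s] laguerre_coeff_def assms(3) using s by (simp flip: mult.assoc)
  finally have "poly_Ber n f z = ?c * (of_real (2 * pi) *
      (of_real (inverse s) * wavelet (Phi n) (inv_fourier (extend_zero f)) x s))"
    unfolding Ber_form by (simp only:)
  then show ?thesis
    using polyanalytic_poly_Ber[OF f] deriv_form Ber_form by (simp only: mult.assoc simp_thms)
qed

end
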